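(* Let $p$ be a prime, $G$ a topological group, and $f : G \to \mathbb{Q}_p$ a continuous unbounded quasimorphism with $D(f) = 1$. Let $U := f^{-1}(\mathbb{Z}_p)$ and $k \geq 0$. Then the following are equivalent: 1. $d_H(f) > p^k$. 2. For every open subgroup $K \leq G$ of index at most $p^k$, the map $\pi\circ f|_K : K \to \mathbb{Z}(p^\infty)$ does not factor through a continuous homomorphism $K \to \mathbb{Q}_p$, i.e. there is no continuous homomorphism $h:K\to\mathbb{Q}_p$ with $\pi\circ f|_K=\pi\circ h$. 3. For every open subgroup $K \leq G$ of index at most $p^k$, every sequence $U \cap K =: U_0 \geq U_1 \geq \cdots$ of open normal subgroups of $K$ such that $K/U_j \cong \mathbb{Z}(p^\infty)$ for all $j$ eventually stabilizes. Moreover, the equivalences remain true if in conditions 2 and 3 "of index at most $p^k$" is replaced by "of index dividing $p^k$" and $K$ is additionally required to be normal in $G$.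
   Context: A quasimorphism is a map $f:G\to\mathbb{Q}_p$ whose defect $D(f)=\sup_{g,h\in G}|f(gh)-f(g)-f(h)|_p$ is finite. $d_H(f)=\inf\{\|f-h\|_\infty : h:G\to\mathbb{Q}_p \text{ continuous homomorphism}\}$. $\mathbb{Z}(p^\infty)=\mathbb{Q}_p/\mathbb{Z}_p$ is the Prüfer $p$-group (with discrete topology), and $\pi:\mathbb{Q}_p\to\mathbb{Q}_p/\mathbb{Z}_p$ the canonical projection; when $D(f)\le1$, $\pi\circ f$ is a continuous homomorphism. *)

theory Defs
  imports "HOL-Analysis.Analysis" "HOL-Algebra.Coset" "HOL-Computational_Algebra.Factorial_Ring"
begin

definition padic_val_rat :: "nat \<Rightarrow> rat \<Rightarrow> int" where
  "padic_val_rat p q = int (multiplicity (int p) (fst (quotient_of q)))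
                       - int (multiplicity (int p) (snd (quotient_of q)))"

definition padic_abs :: "nat \<Rightarrow> rat \<Rightarrow> real" where
  "padic_abs p q = (if q = 0 then 0 else (real p) powi (- padic_val_rat p q))"

definition padic_cauchy :: "nat \<Rightarrow> (nat \<Rightarrow> rat) \<Rightarrow> bool" where
  "padic_cauchy p X \<longleftrightarrow>
     (\<forall>e>0. \<exists>N. \<forall>m\<ge>N. \<forall>n\<ge>N. padic_abs p (X m - X n) < e)"

definition padic_equiv :: "nat \<Rightarrow> (nat \<Rightarrow> rat) \<Rightarrow> (nat \<Rightarrow> rat) \<Rightarrow> bool" where
  "padic_equiv p X Y \<longleftrightarrow> (\<lambda>n. padic_abs p (X n - Y n)) \<longlonglongrightarrow> 0"

definition qp_class :: "nat \<Rightarrow> (nat \<Rightarrow> rat) \<Rightarrow> (nat \<Rightarrow> rat) set" where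
  "qp_class p X = {Y. padic_cauchy p Y \<and> padic_equiv p X Y}"

definition Qp :: "nat \<Rightarrow> (nat \<Rightarrow> rat) set set" where
  "Qp p = {qp_class p X | X. padic_cauchy p X}"

definition qp_rep :: "(nat \<Rightarrow> rat) set \<Rightarrow> nat \<Rightarrow> rat" where
  "qp_rep A = (SOME X. X \<in> A)"

definition qp_zero :: "nat \<Rightarrow> (nat \<Rightarrow> rat) set" where
  "qp_zero p = qp_class p (\<lambda>_. 0)"

definition qp_add :: "nat \<Rightarrow> (nat \<Rightarrow> rat) set \<Rightarrow> (nat \<Rightarrow> rat) set \<Rightarrow> (nat \<Rightarrow> rat) set" where
  "qp_add p A B = qp_class p (\<lambda>n. qp_rep A n + qp_rep B n)"

definition qp_sub :: "nat \<Rightarrow> (nat \<Rightarrow> rat) set \<Rightarrow> (nat \<Rightarrow> rat) set \<Rightarrow> (nat \<Rightarrow> rat) set" where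
  "qp_sub p A B = qp_class p (\<lambda>n. qp_rep A n - qp_rep B n)"

definition qp_abs :: "nat \<Rightarrow> (nat \<Rightarrow> rat) set \<Rightarrow> real" where
  "qp_abs p A = lim (\<lambda>n. padic_abs p (qp_rep A n))"

definition Zp :: "nat \<Rightarrow> (nat \<Rightarrow> rat) set set" where
  "Zp p = {a \<in> Qp p. qp_abs p a \<le> 1}"

definition Qp_group :: "nat \<Rightarrow> (nat \<Rightarrow> rat) set monoid" where
  "Qp_group p = \<lparr>carrier = Qp p, mult = qp_add p, one = qp_zero p\<rparr>"

definition Pruefer :: "nat \<Rightarrow> (nat \<Rightarrow> rat) set set monoid" where
  "Pruefer p = Qp_group p Mod Zp p"

definition topological_group :: "('a, 'b) monoid_scheme \<Rightarrow> 'a topology \<Rightarrow> bool" where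
  "topological_group G T \<longleftrightarrow> group G \<and> topspace T = carrier G \<and>
     continuous_map (prod_topology T T) T (\<lambda>(x, y). x \<otimes>\<^bsub>G\<^esub> y) \<and>
     continuous_map T T (\<lambda>x. inv\<^bsub>G\<^esub> x)"

definition qp_continuous_on :: "nat \<Rightarrow> 'a topology \<Rightarrow> 'a set \<Rightarrow> ('a \<Rightarrow> (nat \<Rightarrow> rat) set) \<Rightarrow> bool" where
  "qp_continuous_on p T S g \<longleftrightarrow> (\<forall>x\<in>S. g x \<in> Qp p) \<and>
     (\<forall>x\<in>S. \<forall>e>0. \<exists>V. openin T V \<and> x \<in> V \<and>
        (\<forall>y\<in>V \<inter> S. qp_abs p (qp_sub p (g y) (g x)) < e))"

definition qp_cont_hom :: "nat \<Rightarrow> ('a, 'b) monoid_scheme \<Rightarrow> 'a topology \<Rightarrow> 'a set \<Rightarrow> ('a \<Rightarrow> (nat \<Rightarrow> rat) set) \<Rightarrow> bool" where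
  "qp_cont_hom p G T K h \<longleftrightarrow> qp_continuous_on p T K h \<and>
     (\<forall>x\<in>K. \<forall>y\<in>K. h (x \<otimes>\<^bsub>G\<^esub> y) = qp_add p (h x) (h y))"

definition defect_set :: "nat \<Rightarrow> ('a, 'b) monoid_scheme \<Rightarrow> ('a \<Rightarrow> (nat \<Rightarrow> rat) set) \<Rightarrow> real set" where
  "defect_set p G f = {qp_abs p (qp_sub p (qp_sub p (f (g \<otimes>\<^bsub>G\<^esub> h)) (f g)) (f h)) | g h.
                         g \<in> carrier G \<and> h \<in> carrier G}"

definition qp_quasimorphism :: "nat \<Rightarrow> ('a, 'b) monoid_scheme \<Rightarrow> ('a \<Rightarrow> (nat \<Rightarrow> rat) set) \<Rightarrow> bool" where
  "qp_quasimorphism p G f \<longleftrightarrow> (\<forall>g\<in>carrier G. f g \<in> Qp p) \<and> bdd_above (defect_set p G f)"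

definition defect :: "nat \<Rightarrow> ('a, 'b) monoid_scheme \<Rightarrow> ('a \<Rightarrow> (nat \<Rightarrow> rat) set) \<Rightarrow> real" where
  "defect p G f = Sup (defect_set p G f)"

definition dist_hom :: "nat \<Rightarrow> ('a, 'b) monoid_scheme \<Rightarrow> 'a topology \<Rightarrow> ('a \<Rightarrow> (nat \<Rightarrow> rat) set) \<Rightarrow> ereal" where
  "dist_hom p G T f = (INF h \<in> {h. qp_cont_hom p G T (carrier G) h}.
        (SUP g \<in> carrier G. ereal (qp_abs p (qp_sub p (f g) (h g)))))"

definition qp_bounded :: "nat \<Rightarrow> ('a, 'b) monoid_scheme \<Rightarrow> ('a \<Rightarrow> (nat \<Rightarrow> rat) set) \<Rightarrow> bool" where
  "qp_bounded p G f \<longleftrightarrow> (\<exists>B. \<forall>g\<in>carrier G. qp_abs p (f g) \<le> B)"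

end

theory Submission
  imports Defs "HOL-Library.Function_Algebras" "HOL-Algebra.Elementary_Groups" "HOL-Number_Theory.Cong"
begin

text \<open>
  Since \<open>D(f) \<le> 1\<close>, the map \<open>f\<close> is a homomorphism modulo \<open>\<int>\<^sub>p\<close>. If \<open>h : K \<rightarrow> \<rat>\<^sub>p\<close> lifts
  it on a subgroup \<open>K\<close> of index \<open>n\<close>, then \<open>1/n\<close> times the transfer of \<open>h\<close> is a homomorphism
  \<open>H\<close> on \<open>G\<close> with \<open>n (f - H)\<close> integral, so \<open>|f - H| \<le> |1/n|\<close>. Conversely, if
  \<open>|f - H| \<le> p\<^sup>k\<close>, then \<open>f - H\<close> is a homomorphism from \<open>G\<close> to \<open>p\<^sup>-\<^sup>k\<int>\<^sub>p/\<int>\<^sub>p\<close>, and \<open>H\<close> lifts \<open>f\<close>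
  on its kernel, which is normal of index dividing \<open>p\<^sup>k\<close>.

  A lift \<open>h\<close> on \<open>K\<close> is unbounded, hence has dense image, and the preimages of \<open>p\<^sup>j\<int>\<^sub>p\<close> form a
  chain that does not stabilize. Conversely, a strictly decreasing chain \<open>V\<^sub>j\<close> with Pruefer quotients
  determines a lift: every \<open>x \<in> K\<close> has a \<open>p\<^sup>j\<close>-th root \<open>y\<^sub>j\<close> modulo \<open>V\<^sub>j\<close>, and it is unique modulo \<open>V\<^sub>0\<close>
  because \<open>V\<^sub>0/V\<^sub>j\<close> contains the whole \<open>p\<^sup>j\<close>-torsion of \<open>K/V\<^sub>j\<close>. So \<open>h(x) = lim p\<^sup>j f(y\<^sub>j)\<close> is
  well defined.
\<close>

locale padic =
  fixes p :: nat
  assumes prime_p: "prime p"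
begin

abbreviation P :: real where "P \<equiv> real p"
abbreviation Q :: rat where "Q \<equiv> of_nat p"

lemma p_gt_1 [simp]: "Suc 0 < p"
  using prime_p prime_gt_Suc_0_nat by blast

lemma p_pos [simp]: "0 < p"
  using p_gt_1 by linarith

lemma P_gt_1: "P > 1"
  by simp

lemma P_powi_pos [simp]: "P powi i > 0"
  by (simp add: zero_less_power_int)

lemma Q_nonzero [simp]: "Q \<noteq> 0"
  using p_gt_1 by simp

lemma p_powi_le_iff [simp]: "P powi i \<le> P powi j \<longleftrightarrow> i \<le> j"
  using power_int_strict_increasing[of _ _ P] power_int_increasing[of i j P] P_gt_1
  by (metis linorder_not_le order_less_imp_le)

lemma p_powi_less_iff [simp]: "P powi i < P powi j \<longleftrightarrow> i < j"
  using p_powi_le_iff[of j i] by linarith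

lemma prime_elem_p: "prime_elem (int p)"
  using prime_p by (simp add: prime_imp_prime_elem)

lemma multiplicity_mult_p:
  "a \<noteq> 0 \<Longrightarrow> b \<noteq> 0 \<Longrightarrow> multiplicity (int p) (a * b) = multiplicity (int p) a + multiplicity (int p) b"
  by (rule prime_elem_multiplicity_mult_distrib[OF prime_elem_p])

subsection \<open>The absolute value on the rationals\<close>

text \<open>Clearing denominators against the reduced fraction gives \<open>a * d = c * b\<close>,
  and the multiplicity of a prime is additive on products. Hence valuations can be read off any
  fraction, reduced or not.\<close>

lemma padic_val_rat_quotient:
  assumes "a \<noteq> 0" "b \<noteq> 0"
  shows "padic_val_rat p (of_int a / of_int b) = int (multiplicity (int p) a) - int (multiplicity (int p) b)"
proof -
  define q where "q = (of_int a / of_int b :: rat)"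
  obtain c d where cd: "quotient_of q = (c, d)" by fastforce
  have d: "d > 0" using cd quotient_of_denom_pos by blast
  have q: "q = of_int c / of_int d" using cd quotient_of_div by blast
  have "of_int (a * d) = (of_int (c * b) :: rat)"
    using q d assms by (simp add: q_def field_simps)
  then have eq: "a * d = c * b" using of_int_eq_iff by blast
  then have c: "c \<noteq> 0" using d assms by auto
  have "multiplicity (int p) a + multiplicity (int p) d = multiplicity (int p) c + multiplicity (int p) b"
    using arg_cong[OF eq, of "multiplicity (int p)"] c d assms
    by (simp add: multiplicity_mult_p)
  then show ?thesis unfolding padic_val_rat_def q_def[symmetric] cd by simp
qed

lemma rat_quotient_cases:
  obtains a b where "b > 0" "q = (of_int a / of_int b :: rat)"
  by (metis prod.collapse quotient_of_denom_pos' quotient_of_div)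

lemma padic_val_rat_mult:
  assumes "q \<noteq> 0" "r \<noteq> 0"
  shows "padic_val_rat p (q * r) = padic_val_rat p q + padic_val_rat p r"
proof -
  obtain a b where ab: "b > 0" "q = of_int a / of_int b" by (rule rat_quotient_cases)
  obtain c d where cd: "d > 0" "r = of_int c / of_int d" by (rule rat_quotient_cases)
  have nz: "a \<noteq> 0" "c \<noteq> 0" using ab cd assms by auto
  have "q * r = of_int (a * c) / of_int (b * d)" using ab cd by simp
  then have "padic_val_rat p (q * r) = int (multiplicity (int p) (a * c)) - int (multiplicity (int p) (b * d))"
    using ab cd nz by (metis padic_val_rat_quotient mult_eq_0_iff less_irrefl)
  then show ?thesis
    using ab cd nz by (simp add: padic_val_rat_quotient multiplicity_mult_p)
qed

lemma padic_abs_0 [simp]: "padic_abs p 0 = 0"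
  by (simp add: padic_abs_def)

lemma padic_abs_nonneg [simp]: "padic_abs p q \<ge> 0"
  by (simp add: padic_abs_def)

lemma padic_abs_mult: "padic_abs p (q * r) = padic_abs p q * padic_abs p r"
  using power_int_add[of P "- padic_val_rat p q" "- padic_val_rat p r"]
  by (simp add: padic_abs_def padic_val_rat_mult)

lemma padic_abs_minus [simp]: "padic_abs p (- q) = padic_abs p q"
proof (cases "q = 0")
  case False
  obtain a b where ab: "b > 0" "q = of_int a / of_int b" by (rule rat_quotient_cases)
  have "padic_val_rat p (of_int (- a) / of_int b) = padic_val_rat p (of_int a / of_int b)"
    using ab False by (subst (1 2) padic_val_rat_quotient) (use multiplicity_times_unit_right[of "- 1" "int p" a] in auto)
  then show ?thesis using ab False by (simp add: padic_abs_def)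
qed auto

lemma padic_abs_of_int_le_iff: "padic_abs p (of_int a) \<le> P powi (- int n) \<longleftrightarrow> int p ^ n dvd a"
proof (cases "a = 0")
  case False
  have "padic_val_rat p (of_int a) = int (multiplicity (int p) a)"
    using padic_val_rat_quotient[of a 1] False by simp
  then show ?thesis
    using False prime_elem_p
    by (subst power_dvd_iff_le_multiplicity)
      (auto simp: padic_abs_def prime_elem_def)
qed auto

lemma padic_abs_of_nat_le_iff: "padic_abs p (of_nat a) \<le> P powi (- int n) \<longleftrightarrow> p ^ n dvd a"
  using padic_abs_of_int_le_iff[of "int a" n] by (simp flip: of_nat_power)

lemma padic_abs_of_int_le_1: "padic_abs p (of_int a) \<le> 1"
  using padic_abs_of_int_le_iff[of a 0] by simp

lemma padic_abs_of_nat_le_1 [simp]: "padic_abs p (of_nat a) \<le> 1"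
  using padic_abs_of_nat_le_iff[of a 0] by simp

lemma padic_abs_p: "padic_abs p Q = P powi (- 1)"
proof -
  have "padic_val_rat p (of_int (int p) / of_int 1) = 1"
    using p_gt_1 prime_elem_p by (subst padic_val_rat_quotient) auto
  then show ?thesis by (simp add: padic_abs_def)
qed

lemma padic_abs_1 [simp]: "padic_abs p 1 = 1"
  by (simp add: padic_abs_def padic_val_rat_def)

lemma padic_abs_inverse: "padic_abs p (inverse q) = inverse (padic_abs p q)"
proof (cases "q = 0")
  case False
  then have "padic_abs p (inverse q) * padic_abs p q = 1"
    by (simp flip: padic_abs_mult)
  then show ?thesis
    by (metis inverse_unique mult.commute)
qed auto

lemma padic_abs_power: "padic_abs p (q ^ n) = padic_abs p q ^ n"
  by (induction n) (auto simp: padic_abs_mult)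

lemma padic_abs_powi: "padic_abs p (Q powi i) = P powi (- i)"
  by (cases "i \<ge> 0")
    (auto simp: power_int_def padic_abs_inverse padic_abs_power padic_abs_p simp flip: power_inverse)

text \<open>Over a common denominator the ultrametric inequality reduces to the integers, where it is
  divisibility of a sum by a power of \<open>p\<close>.\<close>

lemma padic_abs_add_le:
  assumes "padic_abs p q \<le> P powi (- j)" "padic_abs p r \<le> P powi (- j)"
  shows "padic_abs p (q + r) \<le> P powi (- j)"
proof -
  obtain a b where ab: "b > 0" "q = of_int a / of_int b" by (rule rat_quotient_cases)
  obtain c d where cd: "d > 0" "r = of_int c / of_int d" by (rule rat_quotient_cases)
  define e where "e = b * d"
  have e: "e \<noteq> 0" using ab cd by (simp add: e_def)
  define i where "i = padic_val_rat p (of_int e)"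
  have absE: "padic_abs p (of_int e) = P powi (- i)" using e by (simp add: padic_abs_def i_def)
  have key: "padic_abs p s \<le> P powi (- j) \<longleftrightarrow> int p ^ nat (i + j) dvd x"
    if s: "s * of_int e = of_int x" for s x
  proof -
    have "padic_abs p s \<le> P powi (- j) \<longleftrightarrow> padic_abs p s * P powi (- i) \<le> P powi (- j) * P powi (- i)"
      using P_powi_pos[of "- i"] by (simp only: mult_le_cancel_right_pos)
    also have "\<dots> \<longleftrightarrow> padic_abs p (of_int x) \<le> P powi (- (i + j))"
      unfolding absE[symmetric] padic_abs_mult[symmetric] s unfolding absE
      by (simp add: power_int_add[symmetric] add.commute)
    \<comment> \<open>For a negative exponent \<open>i + j\<close> the truncation
      \<open>nat (i + j)\<close> is 0, and both sides hold because integers have absolute value at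
      most 1.\<close>
    also have "\<dots> \<longleftrightarrow> int p ^ nat (i + j) dvd x"
    proof (cases "i + j \<ge> 0")
      case True
      then show ?thesis using padic_abs_of_int_le_iff[of x "nat (i + j)"] by simp
    next
      case False
      then have "P powi 0 \<le> P powi (- (i + j))" by (subst p_powi_le_iff) simp
      then have "padic_abs p (of_int x) \<le> P powi (- (i + j))"
        using padic_abs_of_int_le_1[of x] by (simp only: power_int_0_right)
      then show ?thesis using False by simp
    qed
    finally show ?thesis .
  qed
  have 1: "q * of_int e = of_int (a * d)" "r * of_int e = of_int (c * b)"
    using ab cd by (auto simp: e_def)
  then have "(q + r) * of_int e = of_int (a * d + c * b)" by (simp add: algebra_simps)
  then show ?thesis using assms key 1 by (metis dvd_add)
qed

lemma padic_abs_diff_le: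
  assumes "padic_abs p q \<le> P powi (- j)" "padic_abs p r \<le> P powi (- j)"
  shows "padic_abs p (q - r) \<le> P powi (- j)"
  using padic_abs_add_le[of q j "- r"] assms by simp

lemma padic_abs_cases: "q = 0 \<or> (\<exists>j. padic_abs p q = P powi (- j))"
  by (auto simp: padic_abs_def)

text \<open>Density of the natural numbers in the p-adic integers, at the level of rationals. The
  reduced denominator \<open>d\<close> of \<open>q = c / d\<close> is prime to p, so it has an
  inverse \<open>x\<close> modulo p^n, and \<open>a\<close> is the residue of
  \<open>c * x\<close>.\<close>

lemma padic_abs_approx_nat:
  assumes "padic_abs p q \<le> 1"
  shows "\<exists>a < p ^ n. padic_abs p (q - of_nat a) \<le> P powi (- int n)"
proof -
  obtain c d where cd: "quotient_of q = (c, d)" by fastforce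
  have d: "d > 0" using cd quotient_of_denom_pos by blast
  have q: "q = of_int c / of_int d" using cd quotient_of_div by blast
  have cop: "coprime c d" using cd quotient_of_coprime by blast
  \<comment> \<open>In lowest terms a factor p of \<open>d\<close> cannot cancel, and it would make
    the absolute value of \<open>q\<close> greater than 1.\<close>
  have nd: "\<not> int p dvd d"
  proof
    assume pd: "int p dvd d"
    then have "\<not> int p dvd c" using cop prime_elem_p
      by (metis coprime_common_divisor prime_elem_not_unit)
    then have 1: "multiplicity (int p) c = 0" by (rule not_dvd_imp_multiplicity_0)
    have 2: "multiplicity (int p) d > 0" using pd d prime_elem_p
      by (subst prime_multiplicity_gt_zero_iff) auto
    have "c \<noteq> 0" using pd \<open>\<not> int p dvd c\<close> by auto
    then have "padic_abs p q = P powi (int (multiplicity (int p) d))"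
      using q d 1 padic_val_rat_quotient[of c d] by (simp add: padic_abs_def)
    moreover have "P ^ multiplicity (int p) d > 1" using 2 P_gt_1 by (metis one_less_power)
    ultimately show False using assms by simp
  qed
  then have cop': "coprime d (int p ^ n)"
    using prime_p by (simp add: coprime_commute[of d] prime_imp_coprime)
  have d1: "padic_abs p (of_int d) = 1"
    using d nd padic_val_rat_quotient[of d 1] by (simp add: padic_abs_def not_dvd_imp_multiplicity_0)
  obtain x where "[d * x = 1] (mod int p ^ n)"
    using cong_solve_coprime_int[OF cop'] by blast
  define a where "a = (c * x) mod int p ^ n"
  have pn: "int p ^ n > 0" using p_gt_1 by simp
  have a: "0 \<le> a" "a < int p ^ n" using pn by (simp_all add: a_def)
  have "[d * a = d * (c * x)] (mod int p ^ n)"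
    by (simp add: a_def cong_def mod_mult_right_eq)
  also have "d * (c * x) = c * (d * x)" by simp
  also have "[c * (d * x) = c * 1] (mod int p ^ n)"
    using \<open>[d * x = 1] (mod int p ^ n)\<close> by (rule cong_scalar_left)
  finally have "int p ^ n dvd c - d * a"
    by (metis cong_iff_dvd_diff cong_sym mult_1_right)
  then have "padic_abs p (of_int (c - d * a)) \<le> P powi (- int n)"
    by (simp only: padic_abs_of_int_le_iff)
  moreover have "(q - of_nat (nat a)) * of_int d = of_int (c - d * a)"
    using q d a by (simp add: field_simps)
  then have "padic_abs p (q - of_nat (nat a)) = padic_abs p (of_int (c - d * a))"
    using d1 by (metis padic_abs_mult mult_1_right)
  moreover have "nat a < p ^ n" using a by (metis nat_less_iff of_nat_power)
  ultimately show ?thesis by auto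
qed

end


section \<open>Rational sequences, their valuations and the Cauchy property\<close>

definition scl :: "rat \<Rightarrow> (nat \<Rightarrow> rat) \<Rightarrow> nat \<Rightarrow> rat"
  where "scl c X = (\<lambda>n. c * X n)"

lemma scl_apply: "scl c X n = c * X n"
  by (simp add: scl_def)

lemma scl_add: "scl c (X + Y) = scl c X + scl c Y"
  and scl_diff: "scl c (X - Y) = scl c X - scl c Y"
  and scl_scl: "scl c (scl d X) = scl (c * d) X"
  and scl_add_left: "scl (c + d) X = scl c X + scl d X"
  and scl_0_left [simp]: "scl 0 X = 0"
  and scl_0_right [simp]: "scl c 0 = 0"
  and scl_1 [simp]: "scl 1 X = X"
  by (auto simp: scl_def fun_eq_iff algebra_simps)

context padic
begin

text \<open>For a Cauchy sequence, \<open>vge j X\<close> says that the represented number has valuation at least \<open>j\<close>.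
  Computing with representatives and this predicate, which is meaningful for all sequences, avoids
  carrying membership in \<open>Qp p\<close> through every calculation.\<close>

definition vge :: "int \<Rightarrow> (nat \<Rightarrow> rat) \<Rightarrow> bool"
  where "vge j X \<longleftrightarrow> (\<forall>\<^sub>F n in sequentially. padic_abs p (X n) \<le> P powi (- j))"

lemma padic_abs_bound: "\<exists>i. padic_abs p q \<le> P powi (- i)"
  by (cases "q = 0") (use padic_abs_cases[of q] in \<open>auto intro: less_imp_le\<close>)

lemma vge_0 [simp]: "vge j 0"
  by (simp add: vge_def)

lemma vge_add:
  assumes "vge j X" "vge j Y"
  shows "vge j (X + Y)"
  using assms unfolding vge_def by eventually_elim (simp add: padic_abs_add_le)

lemma vge_uminus [simp]: "vge j (- X) \<longleftrightarrow> vge j X"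
  by (simp add: vge_def)

lemma vge_diff: "vge j X \<Longrightarrow> vge j Y \<Longrightarrow> vge j (X - Y)"
  using vge_add[of j X "- Y"] by simp

lemma vge_minus_commute: "vge j (X - Y) \<longleftrightarrow> vge j (Y - X)"
  using vge_uminus[of j "X - Y"] by simp

lemma vge_swap: "vge j (X - Y) \<Longrightarrow> vge j (Y - X)"
  by (simp add: vge_minus_commute[of j Y])

lemma vge_trans: "vge j (X - Y) \<Longrightarrow> vge j (Y - Z) \<Longrightarrow> vge j (X - Z)"
  using vge_add[of j "X - Y" "Y - Z"] by simp

text \<open>An ultrametric replacement for rewriting. Many later proofs follow one pattern: known
  congruences are added up, the sum simplifies to a difference of two sequences, and this lemma
  moves the valuation bound from one sequence to the other.\<close>

lemma vge_cong: "vge j (X - Y) \<Longrightarrow> vge j X \<longleftrightarrow> vge j Y"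
  using vge_add[of j "X - Y" Y] vge_diff[of j X "X - Y"] by auto

lemma vge_sum: "(\<And>i. i \<in> I \<Longrightarrow> vge j (F i)) \<Longrightarrow> vge j (\<Sum>i\<in>I. F i)"
  by (induction I rule: infinite_finite_induct) (auto intro: vge_add)

lemma vge_mono: "vge j X \<Longrightarrow> i \<le> j \<Longrightarrow> vge i X"
  unfolding vge_def by (elim eventually_mono) (meson neg_le_iff_le order_trans p_powi_le_iff)

lemma vge_scl:
  assumes "padic_abs p c \<le> P powi (- i)" "vge j X"
  shows "vge (i + j) (scl c X)"
  using assms(2) unfolding vge_def
proof (rule eventually_mono)
  fix n assume "padic_abs p (X n) \<le> P powi (- j)"
  then have "padic_abs p c * padic_abs p (X n) \<le> P powi (- i) * P powi (- j)"
    using assms(1) by (intro mult_mono) auto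
  also have "\<dots> = P powi (- (i + j))"
    using power_int_add[of P "- i" "- j"] by simp
  finally show "padic_abs p (scl c X n) \<le> P powi (- (i + j))"
    by (simp add: scl_apply padic_abs_mult)
qed

lemma vge_scl_nat: "vge j X \<Longrightarrow> vge j (scl (of_nat n) X)"
  using vge_scl[of "of_nat n" 0 j X] by simp

lemma vge_scl_powi [simp]: "vge j (scl (Q powi i) X) \<longleftrightarrow> vge (j - i) X"
proof
  assume "vge j (scl (Q powi i) X)"
  then have "vge (- i + j) (scl (Q powi (- i)) (scl (Q powi i) X))"
    by (intro vge_scl) (simp_all add: padic_abs_powi)
  moreover have "scl (Q powi (- i)) (scl (Q powi i) X) = X"
    by (simp add: scl_scl power_int_minus)
  ultimately show "vge (j - i) X" by simp
next
  assume "vge (j - i) X"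
  then have "vge (i + (j - i)) (scl (Q powi i) X)"
    by (intro vge_scl) (simp_all add: padic_abs_powi)
  then show "vge j (scl (Q powi i) X)" by simp
qed

lemma vge_scl_power [simp]: "vge i (scl (Q ^ j) X) \<longleftrightarrow> vge (i - int j) X"
  using vge_scl_powi[of i "int j" X] by simp

lemma small_powi:
  assumes "e > 0"
  obtains j where "P powi (- int j) < e"
proof -
  obtain n where "inverse P ^ n < e"
    using real_arch_pow_inv[of e "inverse P"] assms by (auto simp: field_simps)
  then show thesis by (intro that[of n]) (simp add: power_int_minus power_inverse)
qed

lemma small_powi_int:
  assumes "e > 0"
  obtains j where "\<And>x. x \<le> P powi (- j) \<Longrightarrow> x < e"
  using small_powi[OF assms] by (metis order_le_less_trans)

lemma padic_cauchy_iff: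
  "padic_cauchy p X \<longleftrightarrow> (\<forall>j. \<forall>\<^sub>F N in sequentially. \<forall>m\<ge>N. padic_abs p (X m - X N) \<le> P powi (- j))"
    (is "?L \<longleftrightarrow> ?R")
proof
  assume L: ?L
  show ?R
  proof
    fix j
    obtain N where "\<forall>m\<ge>N. \<forall>n\<ge>N. padic_abs p (X m - X n) < P powi (- j)"
      using L unfolding padic_cauchy_def by (meson P_powi_pos)
    then show "\<forall>\<^sub>F N in sequentially. \<forall>m\<ge>N. padic_abs p (X m - X N) \<le> P powi (- j)"
      unfolding eventually_sequentially by (meson le_trans less_imp_le)
  qed
next
  assume R: ?R
  show ?L unfolding padic_cauchy_def
  proof (intro allI impI)
    fix e :: real assume "e > 0"
    then obtain j where j: "\<And>x. x \<le> P powi (- j) \<Longrightarrow> x < e" using small_powi_int by metis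
    obtain N where N: "\<forall>m\<ge>N. padic_abs p (X m - X N) \<le> P powi (- j)"
      using R unfolding eventually_sequentially by blast
    have "padic_abs p (X m - X n) < e" if "m \<ge> N" "n \<ge> N" for m n
      using padic_abs_diff_le[of "X m - X N" j "X n - X N"] N that j by simp
    then show "\<exists>N. \<forall>m\<ge>N. \<forall>n\<ge>N. padic_abs p (X m - X n) < e" by blast
  qed
qed

text \<open>One term \<open>X N\<close> that is eventually close to the others is enough: any two
  late terms are close to \<open>X N\<close>, hence to each other.\<close>

lemma padic_cauchy_vge:
  "padic_cauchy p X \<longleftrightarrow> (\<forall>j. \<forall>\<^sub>F N in sequentially. vge j (X - (\<lambda>_. X N)))"
proof -
  have "(\<forall>\<^sub>F N in sequentially. \<forall>m\<ge>N. padic_abs p (X m - X N) \<le> P powi (- j)) \<longleftrightarrow>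
        (\<forall>\<^sub>F N in sequentially. vge j (X - (\<lambda>_. X N)))" (is "?L \<longleftrightarrow> ?R") for j
  proof
    assume ?L
    then show ?R
      by (rule eventually_mono) (auto simp: vge_def eventually_sequentially)
  next
    assume ?R
    then obtain N where "vge j (X - (\<lambda>_. X N))"
      by (auto simp: eventually_sequentially)
    then obtain M where M: "\<And>m. m \<ge> M \<Longrightarrow> padic_abs p (X m - X N) \<le> P powi (- j)"
      by (auto simp: vge_def eventually_sequentially)
    show ?L unfolding eventually_sequentially
    proof (intro exI allI impI)
      fix n m assume "n \<ge> M" "m \<ge> n"
      then show "padic_abs p (X m - X n) \<le> P powi (- j)"
        using padic_abs_diff_le[OF M M, of m n] by simp
    qed
  qed
  then show ?thesis by (simp add: padic_cauchy_iff)
qed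

lemma cauchy_const [simp]: "padic_cauchy p (\<lambda>_. c)"
  by (simp add: padic_cauchy_iff)

lemma cauchy_0 [simp]: "padic_cauchy p 0"
  by (simp add: zero_fun_def)

lemma cauchy_add:
  assumes "padic_cauchy p X" "padic_cauchy p Y"
  shows "padic_cauchy p (X + Y)"
  unfolding padic_cauchy_iff
proof
  fix j
  have "\<forall>\<^sub>F N in sequentially. \<forall>m\<ge>N. padic_abs p (X m - X N) \<le> P powi (- j)"
    "\<forall>\<^sub>F N in sequentially. \<forall>m\<ge>N. padic_abs p (Y m - Y N) \<le> P powi (- j)"
    using assms by (auto simp: padic_cauchy_iff)
  then show "\<forall>\<^sub>F N in sequentially. \<forall>m\<ge>N. padic_abs p ((X + Y) m - (X + Y) N) \<le> P powi (- j)"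
  proof eventually_elim
    case (elim N)
    have "(X + Y) m - (X + Y) N = (X m - X N) + (Y m - Y N)" for m by simp
    then show ?case using elim by (metis padic_abs_add_le)
  qed
qed

lemma cauchy_scl:
  assumes "padic_cauchy p X"
  shows "padic_cauchy p (scl c X)"
proof (cases "c = 0")
  case False
  then obtain i where i: "padic_abs p c \<le> P powi (- i)" using padic_abs_bound by blast
  show ?thesis unfolding padic_cauchy_vge
  proof
    fix j
    have "\<forall>\<^sub>F N in sequentially. vge (j - i) (X - (\<lambda>_. X N))"
      using assms by (auto simp: padic_cauchy_vge)
    then show "\<forall>\<^sub>F N in sequentially. vge j (scl c X - (\<lambda>_. scl c X N))"
    proof eventually_elim
      case (elim N)
      have "vge (i + (j - i)) (scl c (X - (\<lambda>_. X N)))" by (rule vge_scl[OF i elim])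
      moreover have "scl c (X - (\<lambda>_. X N)) = scl c X - (\<lambda>_. scl c X N)"
        by (auto simp: scl_def fun_eq_iff algebra_simps)
      ultimately show ?case by simp
    qed
  qed
qed auto

lemma cauchy_uminus:
  assumes "padic_cauchy p X" shows "padic_cauchy p (- X)"
proof -
  have "- X = scl (- 1) X" by (auto simp: scl_def fun_eq_iff)
  then show ?thesis using cauchy_scl[OF assms, of "- 1"] by simp
qed

lemma cauchy_diff: "padic_cauchy p X \<Longrightarrow> padic_cauchy p Y \<Longrightarrow> padic_cauchy p (X - Y)"
  using cauchy_add[of X "- Y"] cauchy_uminus[of Y] by simp

lemma cauchy_sum: "(\<And>i. i \<in> I \<Longrightarrow> padic_cauchy p (F i)) \<Longrightarrow> padic_cauchy p (\<Sum>i\<in>I. F i)"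
  by (induction I rule: infinite_finite_induct) (auto intro: cauchy_add)

lemma cauchy_bounded:
  assumes "padic_cauchy p X"
  obtains j where "vge j X"
proof -
  obtain N where N: "vge 0 (X - (\<lambda>_. X N))"
    using assms by (auto simp: padic_cauchy_vge eventually_sequentially)
  obtain i where i: "padic_abs p (X N) \<le> P powi (- i)" using padic_abs_bound by blast
  then have "vge i (\<lambda>_. X N)" by (simp add: vge_def)
  then have "vge (min 0 i) ((X - (\<lambda>_. X N)) + (\<lambda>_. X N))"
    using N by (intro vge_add) (auto intro: vge_mono)
  then show thesis using that by simp
qed

text \<open>All terms past some \<open>N\<close> differ by at most p^(-j), yet each exceeds p^(-j)
  in absolute value. The ultrametric inequality then forces their absolute values to
  coincide.\<close>

lemma not_vge_eventually_const:
  assumes "padic_cauchy p X" "\<not> vge j X"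
  obtains l where "l < j" "\<forall>\<^sub>F n in sequentially. padic_abs p (X n) = P powi (- l)"
proof -
  obtain N where N: "\<And>m. m \<ge> N \<Longrightarrow> padic_abs p (X m - X N) \<le> P powi (- j)"
    using assms(1) unfolding padic_cauchy_iff eventually_sequentially by (meson order_refl)
  have gt: "padic_abs p (X m) > P powi (- j)" if "m \<ge> N" for m
  proof (rule ccontr)
    assume "\<not> ?thesis"
    then have m: "padic_abs p (X m) \<le> P powi (- j)" by simp
    have XN: "padic_abs p (X N) \<le> P powi (- j)"
      using padic_abs_diff_le[OF m N[OF that]] by simp
    have "padic_abs p (X n) \<le> P powi (- j)" if "n \<ge> N" for n
      using padic_abs_add_le[OF XN N[OF that]] by simp
    then have "vge j X" by (auto simp: vge_def eventually_sequentially)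
    then show False using assms by simp
  qed
  have le: "padic_abs p (X n) \<le> padic_abs p (X m)" if "m \<ge> N" "n \<ge> N" for m n
  proof -
    have "X m \<noteq> 0" using order.strict_trans[OF P_powi_pos gt[of m]] that by auto
    then obtain l where l: "padic_abs p (X m) = P powi (- l)" using padic_abs_cases by blast
    have "l \<le> j" using gt[of m] that l less_imp_le[of "P powi - j" "P powi - l"] by simp
    then have "P powi (- j) \<le> P powi (- l)" by simp
    moreover have "padic_abs p (X n - X m) \<le> P powi (- j)"
      using padic_abs_diff_le[OF N N] that by fastforce
    ultimately have "padic_abs p (X n - X m) \<le> P powi (- l)" by linarith
    then show ?thesis using padic_abs_add_le[of "X m" l "X n - X m"] l by simp
  qed
  have "X N \<noteq> 0" using order.strict_trans[OF P_powi_pos gt[of N]] by auto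
  then obtain l where l: "padic_abs p (X N) = P powi (- l)" using padic_abs_cases by blast
  have "\<not> P powi (- l) \<le> P powi (- j)" using gt[of N] l by simp
  then have "l < j" by simp
  moreover have "padic_abs p (X n) = P powi (- l)" if "n \<ge> N" for n
    using le[of N n] le[of n N] l that by simp
  ultimately show thesis using that by (auto simp: eventually_sequentially)
qed

text \<open>The hypotheses say that \<open>Y\<close> has valuation at most \<open>j\<close> and
  \<open>X\<close> at least \<open>j\<close>. So X/Y is a p-adic integer, and natural numbers
  approximate it. This serves dense images, the cyclic group of order p^k and torsion in Pruefer
  quotients.\<close>

lemma approx_nat_multiple:
  assumes X: "padic_cauchy p X" and Y: "padic_cauchy p Y" and "vge j X" "\<not> vge (j + 1) Y"
  shows "\<exists>n. vge i (X - scl (of_nat n) Y)"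
proof -
  obtain l where l: "l < j + 1" "\<forall>\<^sub>F n in sequentially. padic_abs p (Y n) = P powi (- l)"
    using not_vge_eventually_const[OF Y assms(4)] by blast
  have "\<forall>\<^sub>F N in sequentially. vge i (X - (\<lambda>_. X N))" "\<forall>\<^sub>F N in sequentially. vge i (Y - (\<lambda>_. Y N))"
    using X Y by (auto simp: padic_cauchy_vge)
  with assms(3)[unfolded vge_def] l(2)
  have "\<forall>\<^sub>F N in sequentially. padic_abs p (X N) \<le> P powi (- j) \<and> padic_abs p (Y N) = P powi (- l)
    \<and> vge i (X - (\<lambda>_. X N)) \<and> vge i (Y - (\<lambda>_. Y N))"
    by eventually_elim blast
  then obtain N where N: "padic_abs p (X N) \<le> P powi (- j)" "padic_abs p (Y N) = P powi (- l)"
    "vge i (X - (\<lambda>_. X N))" "vge i (Y - (\<lambda>_. Y N))"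
    by (auto simp: eventually_sequentially)
  have Y0: "Y N \<noteq> 0" using N(2) P_powi_pos[of "- l"] by (metis less_irrefl padic_abs_0)
  have "padic_abs p (X N) \<le> P powi (- l)"
    using N(1) l(1) p_powi_le_iff[of "- j" "- l"] by linarith
  then have "padic_abs p (X N / Y N) \<le> 1"
    unfolding divide_inverse padic_abs_mult padic_abs_inverse N(2) by (simp add: field_simps)
  \<comment> \<open>Precision \<open>i - l\<close> suffices because the error gets multiplied by
    \<open>Y N\<close>, of absolute value p^(-l); for \<open>i < l\<close> the truncation by
    \<open>nat\<close> only raises the precision.\<close>
  then obtain n where n: "padic_abs p (X N / Y N - of_nat n) \<le> P powi (- int (nat (i - l)))"
    using padic_abs_approx_nat by blast
  have "padic_abs p (X N - of_nat n * Y N) = padic_abs p (X N / Y N - of_nat n) * P powi (- l)"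
    unfolding N(2)[symmetric] padic_abs_mult[symmetric] using Y0 by (simp add: left_diff_distrib)
  also have "\<dots> \<le> P powi (- int (nat (i - l))) * P powi (- l)"
    using n by (intro mult_right_mono) auto
  also have "\<dots> = P powi (- int (nat (i - l)) - l)"
    using power_int_add[of P "- int (nat (i - l))" "- l"] by simp
  also have "\<dots> \<le> P powi (- i)" by (subst p_powi_le_iff) simp
  finally have "vge i ((\<lambda>_. X N) - scl (of_nat n) (\<lambda>_. Y N))"
    by (simp add: vge_def scl_apply)
  then have "vge i ((X - (\<lambda>_. X N)) + ((\<lambda>_. X N) - scl (of_nat n) (\<lambda>_. Y N)) - scl (of_nat n) (Y - (\<lambda>_. Y N)))"
    using N(3,4) by (intro vge_add[OF N(3)] vge_diff[OF vge_add] vge_scl_nat)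
  then show ?thesis by (auto simp: scl_diff)
qed

subsection \<open>The field of p-adic numbers and representing sequences\<close>

lemma cauchy_lim_const:
  assumes "\<forall>\<^sub>F n in sequentially. padic_abs p (X n) = c"
  shows "lim (\<lambda>n. padic_abs p (X n)) = c"
  using assms by (intro limI tendsto_eventually)

lemma vge_all_tendsto: "(\<lambda>n. padic_abs p (X n)) \<longlonglongrightarrow> 0 \<longleftrightarrow> (\<forall>j. vge j X)"
proof
  assume L: "(\<lambda>n. padic_abs p (X n)) \<longlonglongrightarrow> 0"
  show "\<forall>j. vge j X"
    unfolding vge_def using order_tendstoD(2)[OF L P_powi_pos] by (blast intro: eventually_mono less_imp_le)
next
  assume R: "\<forall>j. vge j X"
  show "(\<lambda>n. padic_abs p (X n)) \<longlonglongrightarrow> 0"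
  proof (rule order_tendstoI)
    fix e :: real assume "0 < e"
    then obtain j where j: "\<And>x. x \<le> P powi (- j) \<Longrightarrow> x < e" using small_powi_int by metis
    show "\<forall>\<^sub>F n in sequentially. padic_abs p (X n) < e"
      using R[rule_format, of j] unfolding vge_def by (rule eventually_mono) (rule j)
  qed (simp add: order_less_le_trans[OF _ padic_abs_nonneg])
qed

text \<open>The second equivalence holds because nonzero absolute values are powers of p: none lies
  strictly between p^(-j) and p^(1-j). This gap later turns a bound on an infimum into a bound on an
  actual distance.\<close>

lemma lim_le_iff_vge:
  assumes "padic_cauchy p X"
  shows "lim (\<lambda>n. padic_abs p (X n)) \<le> P powi (- j) \<longleftrightarrow> vge j X" (is ?A)
    and "lim (\<lambda>n. padic_abs p (X n)) < P powi (1 - j) \<longleftrightarrow> vge j X" (is ?B)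
proof -
  have step: "P powi (- j) < P powi (1 - j)"
    by simp
  have "lim (\<lambda>n. padic_abs p (X n)) \<le> P powi (- j)" if v: "vge j X"
  proof (cases "\<forall>j. vge j X")
    case True
    then have "lim (\<lambda>n. padic_abs p (X n)) = 0" using vge_all_tendsto limI by blast
    then show ?thesis by (simp add: less_imp_le)
  next
    case False
    then obtain i l where l: "\<forall>\<^sub>F n in sequentially. padic_abs p (X n) = P powi (- l)"
      using not_vge_eventually_const[OF assms] by blast
    have "\<forall>\<^sub>F n in sequentially. P powi (- l) \<le> P powi (- j)"
      using v[unfolded vge_def] l by eventually_elim simp
    then show ?thesis using cauchy_lim_const[OF l] by simp
  qed
  moreover have "lim (\<lambda>n. padic_abs p (X n)) \<ge> P powi (1 - j)" if nv: "\<not> vge j X"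
  proof -
    obtain l where "l < j" "\<forall>\<^sub>F n in sequentially. padic_abs p (X n) = P powi (- l)"
      using not_vge_eventually_const[OF assms nv] by blast
    then show ?thesis using cauchy_lim_const by simp
  qed
  ultimately show ?A ?B using step by linarith+
qed

lemma padic_equiv_iff: "padic_equiv p X Y \<longleftrightarrow> (\<forall>j. vge j (X - Y))"
  using vge_all_tendsto[of "X - Y"] by (simp add: padic_equiv_def)

text \<open>The representative picked by \<open>qp_rep\<close> is arbitrary. It differs from
  \<open>X\<close> by a null sequence, a difference that no \<open>vge j\<close> can detect.\<close>

lemma rep_class:
  assumes "padic_cauchy p X"
  shows "padic_cauchy p (qp_rep (qp_class p X))" "vge j (qp_rep (qp_class p X) - X)"
proof -
  have "X \<in> qp_class p X" using assms by (simp add: qp_class_def padic_equiv_iff)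
  then have "qp_rep (qp_class p X) \<in> qp_class p X" by (simp add: qp_rep_def someI[of "\<lambda>X. X \<in> qp_class p _"])
  then show "padic_cauchy p (qp_rep (qp_class p X))" "vge j (qp_rep (qp_class p X) - X)"
    by (auto simp: qp_class_def padic_equiv_iff vge_minus_commute)
qed

lemma class_in_Qp: "padic_cauchy p X \<Longrightarrow> qp_class p X \<in> Qp p"
  by (auto simp: Qp_def)

lemma class_eq_iff:
  assumes "padic_cauchy p X" "padic_cauchy p Y"
  shows "qp_class p X = qp_class p Y \<longleftrightarrow> (\<forall>j. vge j (X - Y))"
proof
  assume "qp_class p X = qp_class p Y"
  then show "\<forall>j. vge j (X - Y)"
    using rep_class[OF assms(1)] rep_class[OF assms(2)] by (metis vge_minus_commute vge_trans)
next
  assume "\<forall>j. vge j (X - Y)"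
  then have "(\<forall>j. vge j (X - Z)) \<longleftrightarrow> (\<forall>j. vge j (Y - Z))" for Z
    by (meson vge_minus_commute vge_trans)
  then show "qp_class p X = qp_class p Y" by (simp add: qp_class_def padic_equiv_iff)
qed

lemma rep_cauchy: "A \<in> Qp p \<Longrightarrow> padic_cauchy p (qp_rep A)"
  by (auto simp: Qp_def rep_class)

lemma class_rep:
  assumes "A \<in> Qp p"
  shows "qp_class p (qp_rep A) = A"
proof -
  obtain X where "padic_cauchy p X" "A = qp_class p X" using assms by (auto simp: Qp_def)
  then show ?thesis by (simp add: class_eq_iff rep_class)
qed

lemma Qp_eq_iff:
  assumes "A \<in> Qp p" "B \<in> Qp p"
  shows "A = B \<longleftrightarrow> (\<forall>j. vge j (qp_rep A - qp_rep B))"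
  using class_eq_iff[OF rep_cauchy[OF assms(1)] rep_cauchy[OF assms(2)]] assms by (simp add: class_rep)

lemma vge_rep_class: "padic_cauchy p X \<Longrightarrow> vge j (qp_rep (qp_class p X)) \<longleftrightarrow> vge j X"
  using rep_class(2) vge_cong by blast

lemma qp_add_alt: "qp_add p A B = qp_class p (qp_rep A + qp_rep B)"
  and qp_sub_alt: "qp_sub p A B = qp_class p (qp_rep A - qp_rep B)"
  and qp_zero_alt: "qp_zero p = qp_class p 0"
  by (simp_all add: qp_add_def qp_sub_def qp_zero_def plus_fun_def fun_diff_def zero_fun_def)

lemma qp_add_closed: "A \<in> Qp p \<Longrightarrow> B \<in> Qp p \<Longrightarrow> qp_add p A B \<in> Qp p"
  and qp_sub_closed: "A \<in> Qp p \<Longrightarrow> B \<in> Qp p \<Longrightarrow> qp_sub p A B \<in> Qp p"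
  and qp_zero_closed: "qp_zero p \<in> Qp p"
  by (simp_all add: qp_add_alt qp_sub_alt qp_zero_alt class_in_Qp rep_cauchy cauchy_add cauchy_diff)

lemma qp_abs_le_iff: "A \<in> Qp p \<Longrightarrow> qp_abs p A \<le> P powi (- j) \<longleftrightarrow> vge j (qp_rep A)"
  and qp_abs_less_iff: "A \<in> Qp p \<Longrightarrow> qp_abs p A < P powi (1 - j) \<longleftrightarrow> vge j (qp_rep A)"
  by (simp_all add: qp_abs_def lim_le_iff_vge rep_cauchy)

lemma vge_rep_sub:
  "A \<in> Qp p \<Longrightarrow> B \<in> Qp p \<Longrightarrow> vge j (qp_rep (qp_sub p A B)) \<longleftrightarrow> vge j (qp_rep A - qp_rep B)"
  by (simp add: qp_sub_alt vge_rep_class rep_cauchy cauchy_diff)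

lemma Zp_iff: "A \<in> Zp p \<longleftrightarrow> A \<in> Qp p \<and> vge 0 (qp_rep A)"
  using qp_abs_le_iff[of A 0] by (auto simp: Zp_def)

lemma eq_qp_add_iff:
  assumes "A \<in> Qp p" "B \<in> Qp p" "C \<in> Qp p"
  shows "C = qp_add p A B \<longleftrightarrow> (\<forall>j. vge j (qp_rep C - qp_rep A - qp_rep B))"
proof -
  have "C = qp_add p A B \<longleftrightarrow> qp_class p (qp_rep C) = qp_class p (qp_rep A + qp_rep B)"
    using assms by (simp add: class_rep qp_add_alt)
  also have "\<dots> \<longleftrightarrow> (\<forall>j. vge j (qp_rep C - qp_rep A - qp_rep B))"
    using assms by (subst class_eq_iff) (auto simp: rep_cauchy cauchy_add diff_diff_eq)
  finally show ?thesis .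
qed

end


subsection \<open>Topological groups\<close>

text \<open>Multiplication takes place on both sides so that conjugates of open sets, which occur in
  the transfer, are covered; left translation is the case where \<open>b\<close> is the
  identity.\<close>

lemma topological_group_openin_translate:
  assumes G: "topological_group G T" and V: "openin T V" and a: "a \<in> carrier G" and b: "b \<in> carrier G"
  shows "openin T {y \<in> carrier G. a \<otimes>\<^bsub>G\<^esub> y \<otimes>\<^bsub>G\<^esub> b \<in> V}"
proof -
  have top: "topspace T = carrier G"
    and mult: "continuous_map (prod_topology T T) T (\<lambda>(x, y). x \<otimes>\<^bsub>G\<^esub> y)"
    using G by (auto simp: topological_group_def)
  have m: "continuous_map T T (\<lambda>y. u y \<otimes>\<^bsub>G\<^esub> v y)" if "continuous_map T T u" "continuous_map T T v" for u v
    using continuous_map_compose[OF _ mult, of T "\<lambda>y. (u y, v y)"] that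
    by (simp add: continuous_map_pairedI o_def)
  have "continuous_map T T (\<lambda>y. a \<otimes>\<^bsub>G\<^esub> y \<otimes>\<^bsub>G\<^esub> b)"
    using a b top by (intro m) auto
  from openin_continuous_map_preimage[OF this V] show ?thesis by (simp add: top)
qed

text \<open>A neighborhood of the identity inside \<open>K\<close> can be moved to any x in
  \<open>K\<close>: if x^(-1) y lies in \<open>V\<close>, then y = x (x^(-1) y) lies in
  \<open>K\<close>.\<close>

lemma topological_group_open_subgroup:
  fixes G (structure)
  assumes G: "topological_group G T" and K: "subgroup K G"
    and V: "openin T V" "\<one> \<in> V" "V \<inter> carrier G \<subseteq> K"
  shows "openin T K"
proof (subst openin_subopen, intro ballI)
  interpret group G using G by (simp add: topological_group_def)
  fix x assume x: "x \<in> K"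
  then have xG: "x \<in> carrier G" using K subgroup.subset by blast
  let ?W = "{y \<in> carrier G. inv x \<otimes> y \<otimes> \<one> \<in> V}"
  have "openin T ?W" using topological_group_openin_translate[OF G V(1)] xG by simp
  moreover have "x \<in> ?W" using xG V by simp
  moreover have "?W \<subseteq> K"
  proof
    fix y assume y: "y \<in> ?W"
    then have "inv x \<otimes> y \<in> K" using V xG by auto
    then have "x \<otimes> (inv x \<otimes> y) \<in> K" using x K by (simp add: subgroup.m_closed)
    then show "y \<in> K" using xG y by (simp flip: m_assoc)
  qed
  ultimately show "\<exists>W. openin T W \<and> x \<in> W \<and> W \<subseteq> K" by blast
qed

context padic
begin

subsection \<open>Homomorphisms modulo a power of p\<close>

text \<open>At \<open>j = 0\<close> these are homomorphisms to the Pruefer group; the condition for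
  all \<open>j\<close> together describes homomorphisms to Q_p.\<close>

definition hom_mod :: "int \<Rightarrow> ('a, 'b) monoid_scheme \<Rightarrow> 'a set \<Rightarrow> ('a \<Rightarrow> nat \<Rightarrow> rat) \<Rightarrow> bool"
  where "hom_mod j G K F \<longleftrightarrow> (\<forall>x\<in>K. padic_cauchy p (F x)) \<and>
    (\<forall>x\<in>K. \<forall>y\<in>K. vge j (F (x \<otimes>\<^bsub>G\<^esub> y) - F x - F y))"

lemma hom_modD:
  assumes "hom_mod j G K F" "x \<in> K"
  shows "padic_cauchy p (F x)" "y \<in> K \<Longrightarrow> vge j (F (x \<otimes>\<^bsub>G\<^esub> y) - F x - F y)"
  using assms by (auto simp: hom_mod_def)

lemma hom_mod_mono: "hom_mod j G K F \<Longrightarrow> i \<le> j \<Longrightarrow> hom_mod i G K F"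
  by (auto simp: hom_mod_def intro: vge_mono)

lemma hom_mod_subset: "hom_mod j G K F \<Longrightarrow> L \<subseteq> K \<Longrightarrow> hom_mod j G L F"
  by (auto simp: hom_mod_def)

lemma hom_mod_restrict [simp]: "hom_mod j (G\<lparr>carrier := K\<rparr>) L F \<longleftrightarrow> hom_mod j G L F"
  by (simp add: hom_mod_def)

lemma hom_mod_diff:
  assumes "hom_mod j G K E" "hom_mod j G K F"
  shows "hom_mod j G K (\<lambda>x. E x - F x)"
  unfolding hom_mod_def
proof (intro conjI ballI)
  fix x y assume xy: "x \<in> K" "y \<in> K"
  have "vge j ((E (x \<otimes>\<^bsub>G\<^esub> y) - E x - E y) - (F (x \<otimes>\<^bsub>G\<^esub> y) - F x - F y))"
    using assms xy by (intro vge_diff[OF hom_modD(2) hom_modD(2)])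
  then show "vge j (E (x \<otimes>\<^bsub>G\<^esub> y) - F (x \<otimes>\<^bsub>G\<^esub> y) - (E x - F x) - (E y - F y))"
    by (simp add: algebra_simps)
qed (use assms in \<open>auto simp: hom_mod_def intro: cauchy_diff\<close>)

lemma hom_mod_scl:
  assumes "hom_mod j G K F"
  shows "hom_mod (j + i) G K (\<lambda>x. scl (Q powi i) (F x))"
  using assms unfolding hom_mod_def by (auto simp: cauchy_scl simp flip: scl_diff)

context
  fixes G :: "('a, 'b) monoid_scheme" (structure) and K :: "'a set" and j :: int
    and F :: "'a \<Rightarrow> nat \<Rightarrow> rat"
  assumes G: "group G" and K: "subgroup K G" and hm: "hom_mod j G K F"
begin

interpretation group G by (rule G)
interpretation subgroup K G by (rule K)

lemma hom_mod_one: "vge j (F \<one>)"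
  using hom_modD(2)[OF hm one_closed one_closed] by simp

lemma hom_mod_inv: "x \<in> K \<Longrightarrow> vge j (F (inv x) + F x)"
  using vge_diff[OF hom_mod_one hom_modD(2)[OF hm, of "inv x" x]] by (simp add: algebra_simps)

lemma hom_mod_mult_inv:
  assumes "x \<in> K" "y \<in> K"
  shows "vge j (F (x \<otimes> inv y) - (F x - F y))"
proof -
  have "vge j ((F (x \<otimes> inv y) - F x - F (inv y)) + (F (inv y) + F y))"
    using assms by (intro vge_add[OF hom_modD(2)[OF hm] hom_mod_inv]) auto
  then show ?thesis by (simp add: algebra_simps)
qed

lemma hom_mod_inv_mult:
  assumes "x \<in> K" "y \<in> K"
  shows "vge j (F (inv x \<otimes> y) - (F y - F x))"
proof -
  have "vge j ((F (inv x \<otimes> y) - F (inv x) - F y) + (F (inv x) + F x))"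
    using assms by (intro vge_add[OF hom_modD(2)[OF hm] hom_mod_inv]) auto
  then show ?thesis by (simp add: algebra_simps)
qed

lemma pow_in_subgroup: "x \<in> K \<Longrightarrow> x [^] (n :: nat) \<in> K"
  by (induction n) auto

lemma hom_mod_pow:
  assumes "x \<in> K"
  shows "vge j (F (x [^] (n :: nat)) - scl (of_nat n) (F x))"
proof (induction n)
  case 0
  then show ?case using hom_mod_one by simp
next
  case (Suc n)
  have "vge j ((F (x [^] n \<otimes> x) - F (x [^] n) - F x) + (F (x [^] n) - scl (of_nat n) (F x)))"
    by (rule vge_add[OF hom_modD(2)[OF hm pow_in_subgroup[OF assms] assms] Suc])
  then have "vge j (F (x [^] Suc n) - scl (of_nat (Suc n)) (F x))"
    by (simp add: algebra_simps scl_add_left)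
  then show ?case .
qed

lemma hom_mod_kernel_subgroup: "subgroup {x \<in> K. vge j (F x)} G"
proof (rule subgroup.intro)
  fix x y assume xy: "x \<in> {x \<in> K. vge j (F x)}" "y \<in> {x \<in> K. vge j (F x)}"
  then have "vge j ((F (x \<otimes> y) - F x - F y) + (F x + F y))"
    by (intro vge_add[OF hom_modD(2)[OF hm] vge_add]) auto
  then show "x \<otimes> y \<in> {x \<in> K. vge j (F x)}" using xy by simp
next
  fix x assume x: "x \<in> {x \<in> K. vge j (F x)}"
  then show "inv x \<in> {x \<in> K. vge j (F x)}" using vge_diff[OF hom_mod_inv, of x "F x"] by simp
qed (use hom_mod_one in auto)

text \<open>The target Q_p / p^j Z_p is abelian, so conjugation does not change the value of
  \<open>F\<close> modulo p^j Z_p.\<close>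

lemma hom_mod_kernel_normal: "{x \<in> K. vge j (F x)} \<lhd> G\<lparr>carrier := K\<rparr>"
proof -
  interpret GK: group "G\<lparr>carrier := K\<rparr>" by (rule subgroup_is_group[OF G])
  have sub: "subgroup {x \<in> K. vge j (F x)} (G\<lparr>carrier := K\<rparr>)"
    by (rule subgroup_incl[OF hom_mod_kernel_subgroup K]) auto
  show ?thesis unfolding GK.normal_inv_iff
  proof (intro conjI ballI sub)
    fix x h assume x: "x \<in> carrier (G\<lparr>carrier := K\<rparr>)" and h: "h \<in> {x \<in> K. vge j (F x)}"
    then have xK: "x \<in> K" by simp
    have "vge j ((F (x \<otimes> h \<otimes> inv x) - (F (x \<otimes> h) - F x)) + (F (x \<otimes> h) - F x - F h) + F h)"
      using xK h by (intro vge_add[OF vge_add[OF hom_mod_mult_inv hom_modD(2)[OF hm]]]) auto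
    then have "vge j (F (x \<otimes> h \<otimes> inv x))" by simp
    moreover have "inv\<^bsub>G\<lparr>carrier := K\<rparr>\<^esub> x = inv x" by (rule m_inv_consistent[OF K xK])
    ultimately show "x \<otimes>\<^bsub>G\<lparr>carrier := K\<rparr>\<^esub> h \<otimes>\<^bsub>G\<lparr>carrier := K\<rparr>\<^esub> inv\<^bsub>G\<lparr>carrier := K\<rparr>\<^esub> x
        \<in> {x \<in> K. vge j (F x)}"
      using xK h by simp
  qed
qed

end

text \<open>The representatives of a homomorphism are additive only up to null sequences, that is, modulo
  every power of \<open>p\<close>; continuity needs to be required at the identity only.\<close>

definition rep_cont_hom :: "('a, 'b) monoid_scheme \<Rightarrow> 'a topology \<Rightarrow> 'a set \<Rightarrow> ('a \<Rightarrow> nat \<Rightarrow> rat) \<Rightarrow> bool"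
  where "rep_cont_hom G T K F \<longleftrightarrow> (\<forall>j. hom_mod j G K F) \<and>
    (\<forall>j. \<exists>V. openin T V \<and> \<one>\<^bsub>G\<^esub> \<in> V \<and> (\<forall>y\<in>V \<inter> K. vge j (F y)))"

section \<open>Translation between continuous p-adic homomorphisms and their representatives\<close>

lemma qp_continuous_on_iff:
  "qp_continuous_on p T S g \<longleftrightarrow> (\<forall>x\<in>S. g x \<in> Qp p) \<and>
     (\<forall>x\<in>S. \<forall>j. \<exists>V. openin T V \<and> x \<in> V \<and> (\<forall>y\<in>V \<inter> S. vge j (qp_rep (g y) - qp_rep (g x))))"
  (is "_ \<longleftrightarrow> ?Q \<and> ?R")
proof (cases ?Q)
  case Q: True
  have iff: "qp_abs p (qp_sub p (g y) (g x)) \<le> P powi (- j) \<longleftrightarrow> vge j (qp_rep (g y) - qp_rep (g x))"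
    if "x \<in> S" "y \<in> S" for x y j
    using Q that by (simp add: qp_abs_le_iff qp_sub_closed vge_rep_sub)
  have iff': "(\<forall>e>0. \<exists>V. openin T V \<and> x \<in> V \<and> (\<forall>y\<in>V \<inter> S. qp_abs p (qp_sub p (g y) (g x)) < e)) \<longleftrightarrow>
    (\<forall>j. \<exists>V. openin T V \<and> x \<in> V \<and> (\<forall>y\<in>V \<inter> S. vge j (qp_rep (g y) - qp_rep (g x))))"
    (is "?A \<longleftrightarrow> ?B") if x: "x \<in> S" for x
  proof
    assume A: ?A
    show ?B
    proof
      fix j
      obtain V where V: "openin T V" "x \<in> V"
        "\<And>y. y \<in> V \<inter> S \<Longrightarrow> qp_abs p (qp_sub p (g y) (g x)) < P powi (- j)"
        using A P_powi_pos by meson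
      have "\<forall>y\<in>V \<inter> S. vge j (qp_rep (g y) - qp_rep (g x))"
        using V(3) iff[OF x] less_imp_le by blast
      then show "\<exists>V. openin T V \<and> x \<in> V \<and> (\<forall>y\<in>V \<inter> S. vge j (qp_rep (g y) - qp_rep (g x)))"
        using V by blast
    qed
  next
    assume B: ?B
    show ?A
    proof (intro allI impI)
      fix e :: real assume "e > 0"
      then obtain j where j: "\<And>x. x \<le> P powi (- j) \<Longrightarrow> x < e" using small_powi_int by metis
      obtain V where V: "openin T V" "x \<in> V" "\<forall>y\<in>V \<inter> S. vge j (qp_rep (g y) - qp_rep (g x))"
        using B by blast
      have "\<forall>y\<in>V \<inter> S. qp_abs p (qp_sub p (g y) (g x)) < e"
        using V(3) iff[OF x] j by blast
      then show "\<exists>V. openin T V \<and> x \<in> V \<and> (\<forall>y\<in>V \<inter> S. qp_abs p (qp_sub p (g y) (g x)) < e)"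
        using V by blast
    qed
  qed
  show ?thesis using Q unfolding qp_continuous_on_def by (simp add: iff' cong: ball_cong)
qed (auto simp: qp_continuous_on_def)

lemma rep_cont_hom_of_qp:
  assumes G: "group G" and K: "subgroup K G" and h: "qp_cont_hom p G T K h"
  shows "rep_cont_hom G T K (\<lambda>x. qp_rep (h x))"
proof -
  interpret subgroup K G by (rule K)
  have c: "qp_continuous_on p T K h"
    and m: "\<And>x y. x \<in> K \<Longrightarrow> y \<in> K \<Longrightarrow> h (x \<otimes>\<^bsub>G\<^esub> y) = qp_add p (h x) (h y)"
    using h by (auto simp: qp_cont_hom_def)
  have hQ: "\<And>x. x \<in> K \<Longrightarrow> h x \<in> Qp p" using c by (simp add: qp_continuous_on_iff)
  have hm: "hom_mod j G K (\<lambda>x. qp_rep (h x))" for j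
    unfolding hom_mod_def
  proof (intro conjI ballI)
    fix x y assume "x \<in> K" "y \<in> K"
    then show "vge j (qp_rep (h (x \<otimes>\<^bsub>G\<^esub> y)) - qp_rep (h x) - qp_rep (h y))"
      using m eq_qp_add_iff[OF hQ hQ hQ, of x y "x \<otimes>\<^bsub>G\<^esub> y"] by simp
  qed (simp add: hQ rep_cauchy)
  moreover have "\<exists>V. openin T V \<and> \<one>\<^bsub>G\<^esub> \<in> V \<and> (\<forall>y\<in>V \<inter> K. vge j (qp_rep (h y)))" for j
  proof -
    obtain V where "openin T V" "\<one>\<^bsub>G\<^esub> \<in> V" "\<forall>y\<in>V \<inter> K. vge j (qp_rep (h y) - qp_rep (h \<one>\<^bsub>G\<^esub>))"
      using c one_closed unfolding qp_continuous_on_iff by blast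
    then show ?thesis using vge_cong hom_mod_one[OF G K hm] by blast
  qed
  ultimately show ?thesis by (simp add: rep_cont_hom_def)
qed

text \<open>Continuity at the identity spreads to every x by pulling a neighborhood back along left
  translation by x^(-1); additivity compares F(y) - F(x) with the value at x^(-1) y.\<close>

lemma qp_cont_hom_of_rep:
  fixes G (structure)
  assumes TG: "topological_group G T" and K: "subgroup K G" and F: "rep_cont_hom G T K F"
  shows "qp_cont_hom p G T K (\<lambda>x. qp_class p (F x))"
proof -
  interpret group G using TG by (simp add: topological_group_def)
  interpret subgroup K G by (rule K)
  have hm: "hom_mod j G K F" for j using F by (simp add: rep_cont_hom_def)
  have cau: "padic_cauchy p (F x)" if "x \<in> K" for x by (rule hom_modD(1)[OF hm that])
  have cl: "vge j (qp_rep (qp_class p (F x)) - qp_rep (qp_class p (F y))) \<longleftrightarrow> vge j (F x - F y)"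
    if "x \<in> K" "y \<in> K" for x y j
  proof (rule vge_cong)
    have "vge j ((qp_rep (qp_class p (F x)) - F x) - (qp_rep (qp_class p (F y)) - F y))"
      using that by (intro vge_diff[OF rep_class(2) rep_class(2)] cau)
    then show "vge j (qp_rep (qp_class p (F x)) - qp_rep (qp_class p (F y)) - (F x - F y))"
      by (simp add: algebra_simps)
  qed
  have "qp_continuous_on p T K (\<lambda>x. qp_class p (F x))"
    unfolding qp_continuous_on_iff
  proof (intro conjI ballI allI)
    fix x j assume x: "x \<in> K"
    obtain V where V: "openin T V" "\<one> \<in> V" "\<forall>y\<in>V \<inter> K. vge j (F y)"
      using F unfolding rep_cont_hom_def by blast
    let ?W = "{y \<in> carrier G. inv x \<otimes> y \<otimes> \<one> \<in> V}"
    have "vge j (qp_rep (qp_class p (F y)) - qp_rep (qp_class p (F x)))" if y: "y \<in> ?W \<inter> K" for y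
    proof -
      have "inv x \<otimes> y \<in> V \<inter> K" using x y by auto
      then have "vge j (F (inv x \<otimes> y))" using V by blast
      then have "vge j (F y - F x)"
        using vge_cong[OF hom_mod_inv_mult[OF group_axioms K hm, of x y]] x y by blast
      then show ?thesis using x y by (simp add: cl)
    qed
    moreover have "openin T ?W" using topological_group_openin_translate[OF TG V(1)] x by simp
    moreover have "x \<in> ?W" using x V by simp
    ultimately show "\<exists>V. openin T V \<and> x \<in> V \<and>
        (\<forall>y\<in>V \<inter> K. vge j (qp_rep (qp_class p (F y)) - qp_rep (qp_class p (F x))))"
      by blast
  qed (simp add: cau class_in_Qp)
  moreover have "qp_class p (F (x \<otimes> y)) = qp_add p (qp_class p (F x)) (qp_class p (F y))"
    if "x \<in> K" "y \<in> K" for x y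
  proof -
    have "vge j ((qp_rep (qp_class p (F (x \<otimes> y))) - F (x \<otimes> y)) - (qp_rep (qp_class p (F x)) - F x)
       - (qp_rep (qp_class p (F y)) - F y) + (F (x \<otimes> y) - F x - F y))" for j
      by (rule vge_add[OF vge_diff[OF vge_diff[OF rep_class(2) rep_class(2)] rep_class(2)] hom_modD(2)[OF hm]])
        (use that in \<open>simp_all add: cau\<close>)
    then show ?thesis
      using that eq_qp_add_iff[of "qp_class p (F x)" "qp_class p (F y)" "qp_class p (F (x \<otimes> y))"]
      by (simp add: cau class_in_Qp algebra_simps)
  qed
  ultimately show ?thesis by (simp add: qp_cont_hom_def)
qed

text \<open>Used twice: \<open>j = 0\<close> describes lifts of the map to the Pruefer group, and
  \<open>j = - int k\<close> describes homomorphisms at distance at most p^k.\<close>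

lemma ex_qp_cont_hom_iff:
  assumes TG: "topological_group G T" and K: "subgroup K G" and f: "\<And>x. x \<in> K \<Longrightarrow> f x \<in> Qp p"
  shows "(\<exists>h. qp_cont_hom p G T K h \<and> (\<forall>x\<in>K. vge j (qp_rep (qp_sub p (f x) (h x))))) \<longleftrightarrow>
    (\<exists>F. rep_cont_hom G T K F \<and> (\<forall>x\<in>K. vge j (qp_rep (f x) - F x)))"
proof
  assume "\<exists>h. qp_cont_hom p G T K h \<and> (\<forall>x\<in>K. vge j (qp_rep (qp_sub p (f x) (h x))))"
  then obtain h where h: "qp_cont_hom p G T K h" "\<forall>x\<in>K. vge j (qp_rep (qp_sub p (f x) (h x)))" by blast
  have "h x \<in> Qp p" if "x \<in> K" for x
    using h that by (simp add: qp_cont_hom_def qp_continuous_on_def)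
  then have "\<forall>x\<in>K. vge j (qp_rep (f x) - qp_rep (h x))" using h f by (simp add: vge_rep_sub)
  moreover have "rep_cont_hom G T K (\<lambda>x. qp_rep (h x))"
    using rep_cont_hom_of_qp[OF _ K h(1)] TG by (simp add: topological_group_def)
  ultimately show "\<exists>F. rep_cont_hom G T K F \<and> (\<forall>x\<in>K. vge j (qp_rep (f x) - F x))" by blast
next
  assume "\<exists>F. rep_cont_hom G T K F \<and> (\<forall>x\<in>K. vge j (qp_rep (f x) - F x))"
  then obtain F where F: "rep_cont_hom G T K F" "\<forall>x\<in>K. vge j (qp_rep (f x) - F x)" by blast
  have cau: "padic_cauchy p (F x)" if "x \<in> K" for x
    using F that by (auto simp: rep_cont_hom_def hom_mod_def)
  have "\<forall>x\<in>K. vge j (qp_rep (qp_sub p (f x) (qp_class p (F x))))"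
  proof
    fix x assume x: "x \<in> K"
    have "vge j (qp_rep (f x) - qp_rep (qp_class p (F x)))"
      using vge_trans F(2) rep_class(2)[OF cau[OF x]] x by (meson vge_minus_commute)
    then show "vge j (qp_rep (qp_sub p (f x) (qp_class p (F x))))"
      using f x cau by (simp add: vge_rep_sub class_in_Qp)
  qed
  then show "\<exists>h. qp_cont_hom p G T K h \<and> (\<forall>x\<in>K. vge j (qp_rep (qp_sub p (f x) (h x))))"
    using qp_cont_hom_of_rep[OF TG K F(1)] by (intro exI[of _ "\<lambda>x. qp_class p (F x)"]) simp
qed

end


lemma sum_const_scl: "finite I \<Longrightarrow> (\<Sum>i\<in>I. X) = scl (of_nat (card I)) X"
  by (induction I rule: finite_induct) (auto simp: scl_def fun_eq_iff algebra_simps)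

context padic
begin

subsection \<open>Extending a lift from a subgroup of finite index by transfer\<close>

text \<open>Division of the transfer by the index n loses at most a factor p^k, since p^(k+1) does
  not divide n. This is why the conclusion has valuation \<open>- int k\<close>.\<close>

lemma transfer_lift:
  fixes G :: "('a, 'b) monoid_scheme" (structure)
  assumes TG: "topological_group G T" and K: "subgroup K G" and openK: "openin T K"
    and fin: "finite (rcosets K)" and nd: "\<not> p ^ Suc k dvd card (rcosets K)"
    and phi: "hom_mod 0 G (carrier G) \<phi>" and F: "rep_cont_hom G T K F"
    and lift: "\<forall>x\<in>K. vge 0 (\<phi> x - F x)"
  shows "\<exists>H. rep_cont_hom G T (carrier G) H \<and> (\<forall>g\<in>carrier G. vge (- int k) (\<phi> g - H g))"
proof -
  interpret group G using TG by (simp add: topological_group_def)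
  interpret subgroup K G by (rule K)
  have hm: "hom_mod j G K F" for j using F by (simp add: rep_cont_hom_def)
  define R where "R = rcosets K"
  define n where "n = card R"
  have finR: "finite R" using fin by (simp add: R_def)
  have n0: "n > 0"
    using fin subgroup_in_rcosets[OF group_axioms] by (auto simp: n_def R_def card_gt_0_iff)
  \<comment> \<open>The absolute value of \<open>n\<close> exceeds p^(-k-1) and is a power of p,
    hence at least p^(-k). The double minus matches the shape required by
    \<open>vge_scl\<close>.\<close>
  have inv_n: "padic_abs p (1 / of_nat n) \<le> P powi (- (- int k))"
  proof -
    have "\<not> padic_abs p (of_nat n) \<le> P powi (- int (Suc k))"
      using nd by (simp only: padic_abs_of_nat_le_iff n_def R_def not_False_eq_True)
    moreover obtain l where l: "padic_abs p (of_nat n) = P powi (- l)"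
      using padic_abs_cases[of "of_nat n"] n0 by auto
    ultimately have "l \<le> int k" by simp
    then have "P powi l \<le> P powi int k" by (simp only: p_powi_le_iff)
    then show ?thesis by (simp add: divide_inverse padic_abs_inverse l flip: power_int_minus)
  qed
  define t where "t C = (SOME x. x \<in> C)" for C :: "'a set"
  have t: "t C \<in> carrier G" "C = K #> t C" if C: "C \<in> R" for C
  proof -
    obtain a where a: "a \<in> carrier G" "C = K #> a" using C by (auto simp: R_def RCOSETS_def)
    then have "t C \<in> C" unfolding t_def using rcos_self[OF _ K] by (metis someI)
    then show "t C \<in> carrier G" "C = K #> t C"
      using a repr_independence[OF _ _ K] elemrcos_carrier[OF group_axioms] by blast+
  qed
  have act: "C #> g = K #> (t C \<otimes> g)" if "C \<in> R" "g \<in> carrier G" for C g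
    using t[OF that(1)] that(2) coset_mult_assoc subset by metis
  have act_R: "C #> g \<in> R" if "C \<in> R" "g \<in> carrier G" for C g
    using act[OF that] t[OF that(1)] that by (auto simp: R_def rcosetsI subset)
  have act_act: "C #> g #> h = C #> (g \<otimes> h)" if "C \<in> R" "g \<in> carrier G" "h \<in> carrier G" for C g h
    using that rcosets_carrier[OF group_axioms] by (intro coset_mult_assoc) (auto simp: R_def)
  have act_one: "C #> \<one> = C" if "C \<in> R" for C
    using that rcosets_carrier[OF group_axioms] by (intro coset_mult_one) (auto simp: R_def)
  \<comment> \<open>The transfer cocycle: t(C) g = c(g,C) t(Cg), with c(g,C) in
    \<open>K\<close>.\<close>
  define c where "c g C = t C \<otimes> g \<otimes> inv (t (C #> g))" for g C
  have c_K: "c g C \<in> K" if "C \<in> R" "g \<in> carrier G" for C g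
  proof -
    have "t C \<otimes> g \<in> K #> t (C #> g)"
      using t(2)[OF act_R[OF that]] act[OF that] t(1)[OF that(1)] that(2) rcos_self[OF _ K] by simp
    then show ?thesis
      using rcos_module_imp[OF group_axioms t(1)[OF act_R[OF that]]] by (simp add: c_def)
  qed
  have c_mult: "c (g \<otimes> h) C = c g C \<otimes> c h (C #> g)"
    if C: "C \<in> R" and g: "g \<in> carrier G" and h: "h \<in> carrier G" for C g h
  proof -
    have "t C \<in> carrier G" "t (C #> g) \<in> carrier G" "t (C #> (g \<otimes> h)) \<in> carrier G"
      using t(1) act_R C g h by auto
    moreover have "inv a \<otimes> (a \<otimes> b) = b" if "a \<in> carrier G" "b \<in> carrier G" for a b
      using that by (simp flip: m_assoc)
    ultimately show ?thesis using g h act_act[OF C g h] by (simp add: c_def m_assoc)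
  qed
  \<comment> \<open>Right multiplication by \<open>g\<close> permutes the cosets. Together with the
    cocycle identity \<open>c_mult\<close> this makes the sum over all cosets additive.\<close>
  have reindex: "(\<Sum>C\<in>R. E (C #> g)) = (\<Sum>C\<in>R. E C)" if "g \<in> carrier G" for g and E :: "'a set \<Rightarrow> nat \<Rightarrow> rat"
    by (rule sum.reindex_bij_witness[where i = "\<lambda>C. C #> inv g" and j = "\<lambda>C. C #> g"])
      (use that in \<open>auto simp: act_R act_act act_one\<close>)
  define S where "S g = (\<Sum>C\<in>R. F (c g C))" for g
  define H where "H g = scl (1 / of_nat n) (S g)" for g
  have Fc: "padic_cauchy p (F x)" if "x \<in> K" for x by (rule hom_modD(1)[OF hm that])
  have HS: "vge j (scl (1 / of_nat n) X)" if "vge (j + int k) X" for j X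
    using vge_scl[OF inv_n that] by simp
  have S_mult: "vge j (S (g \<otimes> h) - S g - S h)" if g: "g \<in> carrier G" and h: "h \<in> carrier G" for g h j
  proof -
    have "S h = (\<Sum>C\<in>R. F (c h (C #> g)))"
      unfolding S_def using reindex[OF g, of "\<lambda>C. F (c h C)"] by simp
    then have "S (g \<otimes> h) - S g - S h = (\<Sum>C\<in>R. F (c (g \<otimes> h) C) - F (c g C) - F (c h (C #> g)))"
      by (simp add: S_def sum_subtractf)
    moreover have "vge j (F (c (g \<otimes> h) C) - F (c g C) - F (c h (C #> g)))" if "C \<in> R" for C
      using that g h by (simp add: c_mult hom_modD(2)[OF hm] c_K act_R)
    ultimately show ?thesis using vge_sum[of R j] by simp
  qed
  have "hom_mod j G (carrier G) H" for j
    unfolding hom_mod_def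
  proof (intro conjI ballI)
    fix g h assume "g \<in> carrier G" "h \<in> carrier G"
    then have "vge j (scl (1 / of_nat n) (S (g \<otimes> h) - S g - S h))" by (intro HS S_mult)
    then show "vge j (H (g \<otimes> h) - H g - H h)" by (simp add: H_def scl_diff)
  qed (auto simp: H_def S_def intro!: cauchy_scl cauchy_sum Fc c_K)
  moreover have "\<exists>V. openin T V \<and> \<one> \<in> V \<and> (\<forall>g\<in>V \<inter> carrier G. vge j (H g))" for j
  proof -
    obtain V where V: "openin T V" "\<one> \<in> V" "\<forall>y\<in>V \<inter> K. vge (j + int k) (F y)"
      using F unfolding rep_cont_hom_def by blast
    \<comment> \<open>An intersection of finitely many open sets. For g in \<open>W\<close> each
      conjugate of g by t(C) lies in \<open>K\<close>, so g fixes every coset C and c(g,C) is this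
      conjugate, where \<open>F\<close> is small. The extra precision \<open>k\<close> of
      \<open>V\<close> pays for the division by the index.\<close>
    define W where "W = (\<Inter>C\<in>R. {g \<in> carrier G. t C \<otimes> g \<otimes> inv (t C) \<in> V \<inter> K})"
    have "openin T W"
      unfolding W_def
      using finR n0 t(1) V(1) openK
      by (intro openin_INT2 topological_group_openin_translate[OF TG]) (auto simp: n_def)
    moreover have "\<one> \<in> W" using V t(1) by (auto simp: W_def)
    moreover have "vge j (H g)" if g: "g \<in> W" "g \<in> carrier G" for g
    proof -
      have "vge (j + int k) (F (c g C))" if C: "C \<in> R" for C
      proof -
        have gC: "t C \<otimes> g \<otimes> inv (t C) \<in> V \<inter> K" using g C by (auto simp: W_def)
        then have "t C \<otimes> g \<in> K #> t C"
          using rcos_module_rev[OF group_axioms t(1)[OF C], of "t C \<otimes> g"] t(1)[OF C] g by simp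
        then have "K #> t C = K #> (t C \<otimes> g)" by (rule repr_independence[OF _ t(1)[OF C] K])
        then have "C #> g = C" using act[OF C g(2)] t(2)[OF C] by simp
        then show ?thesis using gC V(3) by (simp add: c_def)
      qed
      then show ?thesis unfolding H_def S_def by (intro HS vge_sum)
    qed
    ultimately show ?thesis by blast
  qed
  ultimately have "rep_cont_hom G T (carrier G) H" by (simp add: rep_cont_hom_def)
  moreover have "vge (- int k) (\<phi> g - H g)" if g: "g \<in> carrier G" for g
  proof -
    \<comment> \<open>Modulo Z_p, the value of \<phi> at c(g,C) is \<phi>(t(C)) + \<phi>(g) -
      \<phi>(t(Cg)), and \<open>F\<close> agrees with \<phi> on \<open>K\<close>.\<close>
    have summand: "vge 0 (\<phi> (t C) + \<phi> g - \<phi> (t (C #> g)) - F (c g C))" if C: "C \<in> R" for C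
    proof -
      have tC: "t C \<in> carrier G" "t (C #> g) \<in> carrier G" using t(1) C act_R g by auto
      have "vge 0 (\<phi> (c g C) - (\<phi> (t C \<otimes> g) - \<phi> (t (C #> g))))"
        unfolding c_def using tC g by (intro hom_mod_mult_inv[OF group_axioms subgroup_self phi]) auto
      moreover have "vge 0 (\<phi> (t C \<otimes> g) - \<phi> (t C) - \<phi> g)"
        using tC g by (intro hom_modD(2)[OF phi])
      moreover have "vge 0 (\<phi> (c g C) - F (c g C))" using lift c_K[OF C g] by blast
      ultimately have "vge 0 ((\<phi> (c g C) - F (c g C)) - (\<phi> (c g C) - (\<phi> (t C \<otimes> g) - \<phi> (t (C #> g))))
          - (\<phi> (t C \<otimes> g) - \<phi> (t C) - \<phi> g))"
        using vge_diff by blast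
      then show ?thesis by (simp add: algebra_simps)
    qed
    have "(\<Sum>C\<in>R. \<phi> (t C) + \<phi> g - \<phi> (t (C #> g)) - F (c g C))
        = (\<Sum>C\<in>R. \<phi> (t C)) + (\<Sum>C\<in>R. \<phi> g) - (\<Sum>C\<in>R. \<phi> (t (C #> g))) - S g"
      by (simp add: S_def sum_subtractf sum.distrib)
    \<comment> \<open>The contributions of the coset representatives cancel by reindexing.\<close>
    also have "\<dots> = scl (of_nat n) (\<phi> g) - S g"
      using reindex[OF g, of "\<lambda>C. \<phi> (t C)"] sum_const_scl[OF finR, of "\<phi> g"] by (simp add: n_def)
    finally have eq: "(\<Sum>C\<in>R. \<phi> (t C) + \<phi> g - \<phi> (t (C #> g)) - F (c g C)) = scl (of_nat n) (\<phi> g) - S g" .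
    have "vge 0 (scl (of_nat n) (\<phi> g) - S g)"
      unfolding eq[symmetric] by (intro vge_sum summand)
    then have "vge (- int k) (scl (1 / of_nat n) (scl (of_nat n) (\<phi> g) - S g))"
      by (intro HS) simp
    then show ?thesis using n0 by (simp add: H_def scl_diff scl_scl)
  qed
  ultimately show ?thesis by blast
qed

subsection \<open>Bounded homomorphisms modulo the p-adic integers\<close>

text \<open>Sending a to a p^(-k) identifies the integers modulo p^k with the p^k-torsion of
  Q_p/Z_p; this computes the kernel.\<close>

lemma vge_of_int_iff:
  "vge 0 (scl (of_int a) (\<lambda>_. Q powi (- int k))) \<longleftrightarrow> int (p ^ k) dvd a"
proof -
  have "scl (of_int a) (\<lambda>_. Q powi (- int k)) = scl (Q powi (- int k)) (\<lambda>_. of_int a)"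
    by (simp add: scl_def mult.commute)
  then have "vge 0 (scl (of_int a) (\<lambda>_. Q powi (- int k))) \<longleftrightarrow> vge (int k) (\<lambda>_. of_int a)"
    using vge_scl_powi[of 0 "- int k"] by simp
  also have "\<dots> \<longleftrightarrow> int (p ^ k) dvd a"
    by (simp add: vge_def padic_abs_of_int_le_iff)
  finally show ?thesis .
qed

text \<open>Modulo Z_p the values of \<open>D\<close> lie in p^(-k) Z_p / Z_p, a cyclic group of
  order p^k. So G/K embeds in the integers modulo p^k, and Lagrange's theorem gives the
  divisibility.\<close>

lemma bounded_hom_mod_kernel:
  fixes G :: "('a, 'b) monoid_scheme" (structure)
  assumes G: "group G" and D: "hom_mod 0 G (carrier G) D"
    and bd: "\<forall>g\<in>carrier G. vge (- int k) (D g)"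
  defines "K \<equiv> {x \<in> carrier G. vge 0 (D x)}"
  shows "K \<lhd> G" "finite (rcosets K)" "card (rcosets K) dvd p ^ k"
proof -
  interpret group G by (rule G)
  show normal: "K \<lhd> G"
    using hom_mod_kernel_normal[OF G subgroup_self D] by (simp add: K_def)
  let ?Y = "\<lambda>_ :: nat. Q powi (- int k)"
  let ?Z = "integer_mod_group (p ^ k)"
  have carZ: "carrier ?Z = {0..<int (p ^ k)}" using p_pos by (simp add: carrier_integer_mod_group del: p_pos)
  have ex: "\<exists>a \<in> carrier ?Z. vge 0 (D g - scl (of_int a) ?Y)" if g: "g \<in> carrier G" for g
  proof -
    have "\<not> P powi int k \<le> P powi (int k - 1)" by (subst p_powi_le_iff) simp
    then have "\<not> vge (- int k + 1) ?Y" by (simp add: vge_def padic_abs_powi)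
    then obtain n where n: "vge 0 (D g - scl (of_nat n) ?Y)"
      using approx_nat_multiple[OF hom_modD(1)[OF D g] cauchy_const, of "- int k" _ 0] bd g by blast
    \<comment> \<open>Reducing \<open>n\<close> modulo p^k changes n p^(-k) by an integer, so the
      approximation modulo Z_p survives.\<close>
    define a where "a = int n mod int (p ^ k)"
    have "vge 0 (scl (of_int (int n - a)) ?Y)"
      unfolding vge_of_int_iff by (simp add: a_def)
    then have "vge 0 ((D g - scl (of_nat n) ?Y) + scl (of_int (int n - a)) ?Y)"
      by (rule vge_add[OF n])
    moreover have "(D g - scl (of_nat n) ?Y) + scl (of_int (int n - a)) ?Y = D g - scl (of_int a) ?Y"
      by (simp add: scl_def fun_eq_iff algebra_simps)
    ultimately have "vge 0 (D g - scl (of_int a) ?Y)" by (simp only:)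
    moreover have "a \<in> carrier ?Z" by (simp add: carZ a_def)
    ultimately show ?thesis by blast
  qed
  define \<psi> where "\<psi> g = (SOME a. a \<in> carrier ?Z \<and> vge 0 (D g - scl (of_int a) ?Y))" for g
  have psi: "\<psi> g \<in> carrier ?Z" "vge 0 (D g - scl (of_int (\<psi> g)) ?Y)" if "g \<in> carrier G" for g
    using someI_ex[of "\<lambda>a. a \<in> carrier ?Z \<and> vge 0 (D g - scl (of_int a) ?Y)"] ex[OF that]
    unfolding \<psi>_def by blast+
  have mult: "\<psi> (x \<otimes> y) = (\<psi> x + \<psi> y) mod int (p ^ k)" if x: "x \<in> carrier G" and y: "y \<in> carrier G" for x y
  proof -
    have "vge 0 ((D (x \<otimes> y) - D x - D y) - (D (x \<otimes> y) - scl (of_int (\<psi> (x \<otimes> y))) ?Y)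
       + (D x - scl (of_int (\<psi> x)) ?Y) + (D y - scl (of_int (\<psi> y)) ?Y))"
      by (rule vge_add[OF vge_add[OF vge_diff[OF hom_modD(2)[OF D x y]]]])
        (use psi(2) x y in simp_all)
    moreover have "(D (x \<otimes> y) - D x - D y) - (D (x \<otimes> y) - scl (of_int (\<psi> (x \<otimes> y))) ?Y)
       + (D x - scl (of_int (\<psi> x)) ?Y) + (D y - scl (of_int (\<psi> y)) ?Y)
       = scl (of_int (\<psi> (x \<otimes> y) - (\<psi> x + \<psi> y))) ?Y"
      by (simp add: scl_def fun_eq_iff algebra_simps)
    ultimately have "int (p ^ k) dvd \<psi> (x \<otimes> y) - (\<psi> x + \<psi> y)"
      by (simp only: vge_of_int_iff)
    then have "\<psi> (x \<otimes> y) mod int (p ^ k) = (\<psi> x + \<psi> y) mod int (p ^ k)"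
      by (simp only: mod_eq_dvd_iff)
    then show ?thesis using psi(1)[of "x \<otimes> y"] x y by (simp add: carZ)
  qed
  have "\<psi> \<in> hom G ?Z" using psi(1) mult by (auto simp: hom_def)
  then interpret h: group_hom G ?Z \<psi>
    by (simp add: group_hom_def group_hom_axioms_def G)
  \<comment> \<open>The target is cut down to the image so that the first isomorphism theorem meets
    a surjective map.\<close>
  let ?I = "?Z\<lparr>carrier := \<psi> ` carrier G\<rparr>"
  have sub: "subgroup (\<psi> ` carrier G) ?Z" by (rule h.img_is_subgroup)
  then have gI: "group ?I" using group.subgroup_imp_group by fastforce
  have "\<psi> \<in> hom G ?I" using mult by (auto simp: hom_def)
  then interpret hI: group_hom G ?I \<psi>
    using gI by (simp add: group_hom_def group_hom_axioms_def G)
  have "\<psi> x = 0 \<longleftrightarrow> vge 0 (D x)" if x: "x \<in> carrier G" for x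
  proof -
    have "vge 0 (D x) \<longleftrightarrow> int (p ^ k) dvd \<psi> x"
      using vge_cong[OF psi(2)[OF x]] by (simp only: vge_of_int_iff)
    moreover have "\<psi> x = 0" if "int (p ^ k) dvd \<psi> x"
      using psi(1)[OF x] zdvd_not_zless[of "\<psi> x" "int (p ^ k)"] that unfolding carZ by force
    ultimately show ?thesis by auto
  qed
  then have ker: "kernel G ?I \<psi> = K" by (auto simp: kernel_def K_def)
  have "(G Mod K) \<cong> ?I" using hI.FactGroup_iso ker by simp
  then obtain \<theta> where "\<theta> \<in> iso (G Mod K) ?I" by (auto simp: is_iso_def)
  then have bij: "bij_betw \<theta> (rcosets K) (\<psi> ` carrier G)" by (simp add: iso_def FactGroup_def)
  have finI: "finite (\<psi> ` carrier G)"
    by (rule finite_subset[OF subgroup.subset[OF sub]]) (simp add: carZ)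
  show "finite (rcosets K)" using bij_betw_finite[OF bij] finI by simp
  have "card (rcosets K) = card (\<psi> ` carrier G)" by (rule bij_betw_same_card[OF bij])
  moreover have "order ?Z = p ^ k" by (simp add: order_def carZ nat_power_eq)
  ultimately show "card (rcosets K) dvd p ^ k"
    using group.lagrange[OF group_integer_mod_group sub] by (metis dvd_triv_right)
qed


subsection \<open>The Pruefer group\<close>

lemma rep_add: "A \<in> Qp p \<Longrightarrow> B \<in> Qp p \<Longrightarrow> vge j (qp_rep (qp_add p A B) - qp_rep A - qp_rep B)"
  using eq_qp_add_iff[of A B "qp_add p A B"] by (simp add: qp_add_closed)

lemma Qp_comm_group: "comm_group (Qp_group p)"
proof (rule comm_groupI)
  fix A B C assume "A \<in> carrier (Qp_group p)" "B \<in> carrier (Qp_group p)" "C \<in> carrier (Qp_group p)"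
  then have Q: "A \<in> Qp p" "B \<in> Qp p" "C \<in> Qp p" by (simp_all add: Qp_group_def)
  have "vge j (qp_rep (qp_add p (qp_add p A B) C) - qp_rep (qp_add p A (qp_add p B C)))" for j
  proof -
    have "vge j ((qp_rep (qp_add p (qp_add p A B) C) - qp_rep (qp_add p A B) - qp_rep C)
      + (qp_rep (qp_add p A B) - qp_rep A - qp_rep B)
      - ((qp_rep (qp_add p A (qp_add p B C)) - qp_rep A - qp_rep (qp_add p B C))
      + (qp_rep (qp_add p B C) - qp_rep B - qp_rep C)))"
      by (rule vge_diff[OF vge_add[OF rep_add rep_add] vge_add[OF rep_add rep_add]])
        (simp_all add: Q qp_add_closed)
    then show ?thesis by (simp add: algebra_simps)
  qed
  then show "A \<otimes>\<^bsub>Qp_group p\<^esub> B \<otimes>\<^bsub>Qp_group p\<^esub> C = A \<otimes>\<^bsub>Qp_group p\<^esub> (B \<otimes>\<^bsub>Qp_group p\<^esub> C)"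
    using Q Qp_eq_iff by (simp add: Qp_group_def qp_add_closed)
next
  fix A B show "A \<otimes>\<^bsub>Qp_group p\<^esub> B = B \<otimes>\<^bsub>Qp_group p\<^esub> A"
    by (simp add: Qp_group_def qp_add_alt add.commute)
next
  fix A assume "A \<in> carrier (Qp_group p)"
  then have A: "A \<in> Qp p" by (simp add: Qp_group_def)
  have z: "vge j (qp_rep (qp_zero p))" for j
    by (simp add: qp_zero_alt vge_rep_class)
  have "A = qp_add p (qp_zero p) A"
    using A z by (subst eq_qp_add_iff) (simp_all add: qp_zero_closed)
  then show "\<one>\<^bsub>Qp_group p\<^esub> \<otimes>\<^bsub>Qp_group p\<^esub> A = A" by (simp add: Qp_group_def)
  let ?B = "qp_sub p (qp_zero p) A"
  have B: "?B \<in> Qp p" using A by (simp add: qp_sub_closed qp_zero_closed)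
  have "vge j (qp_rep (qp_zero p) - qp_rep ?B - qp_rep A)" for j
    using rep_class(2)[OF cauchy_diff[OF rep_cauchy[OF qp_zero_closed] rep_cauchy[OF A]]]
    by (subst vge_minus_commute[of _ "qp_rep (qp_zero p) - _"]) (simp add: qp_sub_alt algebra_simps)
  then have "qp_zero p = qp_add p ?B A"
    using A B by (subst eq_qp_add_iff) (simp_all add: qp_zero_closed)
  then show "\<exists>B\<in>carrier (Qp_group p). B \<otimes>\<^bsub>Qp_group p\<^esub> A = \<one>\<^bsub>Qp_group p\<^esub>"
    using B by (intro bexI[of _ ?B]) (simp_all add: Qp_group_def)
qed (simp_all add: Qp_group_def qp_add_closed qp_zero_closed)

text \<open>Brings Q_p itself under the general kernel lemmas: Z_p becomes the kernel of
  \<open>qp_rep\<close> at level 0.\<close>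

lemma hom_mod_rep_Qp: "hom_mod j (Qp_group p) (carrier (Qp_group p)) qp_rep"
  unfolding hom_mod_def by (simp add: Qp_group_def rep_cauchy rep_add)

lemma Zp_normal: "Zp p \<lhd> Qp_group p"
proof -
  interpret comm_group "Qp_group p" by (rule Qp_comm_group)
  have "Zp p = {A \<in> carrier (Qp_group p). vge 0 (qp_rep A)}"
    by (auto simp: Zp_iff Qp_group_def)
  then show ?thesis
    using hom_mod_kernel_subgroup[OF group_axioms subgroup_self hom_mod_rep_Qp]
    by (simp add: subgroup_imp_normal)
qed

definition pruefer_class :: "(nat \<Rightarrow> rat) \<Rightarrow> (nat \<Rightarrow> rat) set set"
  where "pruefer_class X = Zp p #>\<^bsub>Qp_group p\<^esub> qp_class p X"

lemma carrier_Pruefer: "carrier (Pruefer p) = pruefer_class ` {X. padic_cauchy p X}"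
proof -
  have "carrier (Qp_group p) = qp_class p ` {X. padic_cauchy p X}"
    by (auto simp: Qp_group_def Qp_def)
  then show ?thesis
    by (simp add: Pruefer_def carrier_FactGroup pruefer_class_def image_image)
qed

lemma pruefer_class_eq_iff:
  assumes X: "padic_cauchy p X" and Y: "padic_cauchy p Y"
  shows "pruefer_class X = pruefer_class Y \<longleftrightarrow> vge 0 (X - Y)"
proof -
  interpret comm_group "Qp_group p" by (rule Qp_comm_group)
  interpret Z: normal "Zp p" "Qp_group p" by (rule Zp_normal)
  let ?A = "qp_class p X" and ?B = "qp_class p Y"
  have AB: "?A \<in> carrier (Qp_group p)" "?B \<in> carrier (Qp_group p)"
    using X Y by (simp_all add: Qp_group_def class_in_Qp)
  have "pruefer_class X = pruefer_class Y \<longleftrightarrow> ?A \<in> Zp p #>\<^bsub>Qp_group p\<^esub> ?B"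
    using AB repr_independence[OF _ _ Z.subgroup_axioms] repr_independenceD[OF Z.subgroup_axioms]
    unfolding pruefer_class_def by metis
  also have "\<dots> \<longleftrightarrow> ?A \<otimes>\<^bsub>Qp_group p\<^esub> inv\<^bsub>Qp_group p\<^esub> ?B \<in> Zp p"
    using AB by (simp add: Z.rcos_module[OF group_axioms])
  also have "\<dots> \<longleftrightarrow> vge 0 (qp_rep (?A \<otimes>\<^bsub>Qp_group p\<^esub> inv\<^bsub>Qp_group p\<^esub> ?B))"
    using m_closed[OF AB(1) inv_closed[OF AB(2)]] by (simp add: Zp_iff Qp_group_def)
  also have "\<dots> \<longleftrightarrow> vge 0 (qp_rep ?A - qp_rep ?B)"
    by (rule vge_cong[OF hom_mod_mult_inv[OF group_axioms subgroup_self hom_mod_rep_Qp AB]])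
  also have "\<dots> \<longleftrightarrow> vge 0 (X - Y)"
  proof (rule vge_cong)
    have "vge 0 ((qp_rep ?A - X) - (qp_rep ?B - Y))"
      by (rule vge_diff[OF rep_class(2)[OF X] rep_class(2)[OF Y]])
    then show "vge 0 (qp_rep ?A - qp_rep ?B - (X - Y))" by (simp add: algebra_simps)
  qed
  finally show ?thesis .
qed

lemma pruefer_class_mult:
  assumes X: "padic_cauchy p X" and Y: "padic_cauchy p Y"
  shows "pruefer_class X \<otimes>\<^bsub>Pruefer p\<^esub> pruefer_class Y = pruefer_class (X + Y)"
proof -
  interpret normal "Zp p" "Qp_group p" by (rule Zp_normal)
  have "qp_class p (X + Y) = qp_add p (qp_class p X) (qp_class p Y)"
  proof (subst eq_qp_add_iff)
    show "\<forall>j. vge j (qp_rep (qp_class p (X + Y)) - qp_rep (qp_class p X) - qp_rep (qp_class p Y))"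
    proof
      fix j
      have "vge j ((qp_rep (qp_class p (X + Y)) - (X + Y)) - (qp_rep (qp_class p X) - X)
        - (qp_rep (qp_class p Y) - Y))"
        by (rule vge_diff[OF vge_diff[OF rep_class(2) rep_class(2)] rep_class(2)])
          (simp_all add: X Y cauchy_add)
      then show "vge j (qp_rep (qp_class p (X + Y)) - qp_rep (qp_class p X) - qp_rep (qp_class p Y))"
        by (simp add: algebra_simps)
    qed
  qed (simp_all add: X Y cauchy_add class_in_Qp)
  then show ?thesis
    using rcos_sum[of "qp_class p X" "qp_class p Y"] X Y
    by (simp add: pruefer_class_def Pruefer_def Qp_group_def class_in_Qp)
qed

lemma group_Pruefer: "group (Pruefer p)"
  unfolding Pruefer_def by (rule normal.factorgroup_is_group[OF Zp_normal])

text \<open>The first isomorphism theorem for \<theta> followed by the projection to Q_p/Z_p;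
  \<open>surj\<close> makes this composite surjective.\<close>

lemma iso_PrueferI:
  assumes L: "group L" and th: "hom_mod 0 L (carrier L) \<theta>"
    and surj: "\<And>X. padic_cauchy p X \<Longrightarrow> \<exists>x\<in>carrier L. vge 0 (\<theta> x - X)"
  shows "(L Mod {x \<in> carrier L. vge 0 (\<theta> x)}) \<cong> Pruefer p"
proof -
  let ?h = "\<lambda>x. pruefer_class (\<theta> x)"
  have c: "padic_cauchy p (\<theta> x)" if "x \<in> carrier L" for x by (rule hom_modD(1)[OF th that])
  have mult: "?h (x \<otimes>\<^bsub>L\<^esub> y) = ?h x \<otimes>\<^bsub>Pruefer p\<^esub> ?h y" if "x \<in> carrier L" "y \<in> carrier L" for x y
  proof -
    have "x \<otimes>\<^bsub>L\<^esub> y \<in> carrier L" using that L by (simp add: group.is_monoid monoid.m_closed)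
    then show ?thesis
      using that hom_modD(2)[OF th that]
      by (simp add: pruefer_class_mult pruefer_class_eq_iff c cauchy_add diff_diff_eq)
  qed
  have "?h \<in> hom L (Pruefer p)" using c mult by (auto simp: hom_def carrier_Pruefer)
  then interpret h: group_hom L "Pruefer p" ?h
    by (simp add: group_hom_def group_hom_axioms_def L group_Pruefer)
  have "?h x = \<one>\<^bsub>Pruefer p\<^esub> \<longleftrightarrow> vge 0 (\<theta> x)" if x: "x \<in> carrier L" for x
  proof -
    have "pruefer_class (\<theta> \<one>\<^bsub>L\<^esub>) = \<one>\<^bsub>Pruefer p\<^esub>" by (rule h.hom_one)
    then have "?h x = \<one>\<^bsub>Pruefer p\<^esub> \<longleftrightarrow> vge 0 (\<theta> x - \<theta> \<one>\<^bsub>L\<^esub>)"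
      using pruefer_class_eq_iff[OF c[OF x] c[OF h.G.one_closed]] by simp
    also have "\<dots> \<longleftrightarrow> vge 0 (\<theta> x)"
      by (rule vge_cong) (simp add: hom_mod_one[OF L group.subgroup_self[OF L] th])
    finally show ?thesis .
  qed
  then have "kernel L (Pruefer p) ?h = {x \<in> carrier L. vge 0 (\<theta> x)}"
    by (auto simp: kernel_def)
  moreover have "?h ` carrier L = carrier (Pruefer p)"
  proof
    show "carrier (Pruefer p) \<subseteq> ?h ` carrier L"
    proof
      fix A assume "A \<in> carrier (Pruefer p)"
      then obtain X where X: "padic_cauchy p X" "A = pruefer_class X" by (auto simp: carrier_Pruefer)
      then obtain x where x: "x \<in> carrier L" "vge 0 (\<theta> x - X)" using surj by blast
      then have "A = ?h x" using X pruefer_class_eq_iff[OF c[OF x(1)] X(1)] by simp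
      then show "A \<in> ?h ` carrier L" using x(1) by blast
    qed
  qed (use c in \<open>auto simp: carrier_Pruefer\<close>)
  ultimately show ?thesis using h.FactGroup_iso by simp
qed

text \<open>Replaces an abstract isomorphism by a choice of Cauchy sequences, so that arithmetic in
  L/V becomes arithmetic of valuations.\<close>

lemma iso_PrueferE:
  assumes L: "group L" and V: "V \<lhd> L" and iso: "(L Mod V) \<cong> Pruefer p"
  obtains \<theta> where "hom_mod 0 L (carrier L) \<theta>"
    and "\<And>x. x \<in> carrier L \<Longrightarrow> vge 0 (\<theta> x) \<longleftrightarrow> x \<in> V"
    and "\<And>X. padic_cauchy p X \<Longrightarrow> \<exists>x\<in>carrier L. vge 0 (\<theta> x - X)"
proof -
  interpret L: group L by (rule L)
  interpret V: normal V L by (rule V)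
  obtain i where i: "i \<in> iso (L Mod V) (Pruefer p)" using iso by (auto simp: is_iso_def)
  define h where "h x = i (V #>\<^bsub>L\<^esub> x)" for x
  have "i \<in> hom (L Mod V) (Pruefer p)" using i by (simp add: iso_def)
  then have "i \<circ> (\<lambda>x. V #>\<^bsub>L\<^esub> x) \<in> hom L (Pruefer p)"
    by (rule hom_compose[OF V.r_coset_hom_Mod])
  then have h: "h \<in> hom L (Pruefer p)" by (simp add: h_def[abs_def] o_def)
  have bij: "bij_betw i (rcosets\<^bsub>L\<^esub> V) (carrier (Pruefer p))"
    using i by (simp add: iso_def FactGroup_def)
  define \<theta> where "\<theta> x = (SOME X. padic_cauchy p X \<and> h x = pruefer_class X)" for x
  have th: "padic_cauchy p (\<theta> x)" "h x = pruefer_class (\<theta> x)" if "x \<in> carrier L" for x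
  proof -
    have "\<exists>X. padic_cauchy p X \<and> h x = pruefer_class X"
      using hom_in_carrier[OF h that] by (auto simp: carrier_Pruefer)
    from someI_ex[OF this] show "padic_cauchy p (\<theta> x)" "h x = pruefer_class (\<theta> x)"
      by (simp_all add: \<theta>_def)
  qed
  have hm: "hom_mod 0 L (carrier L) \<theta>"
    unfolding hom_mod_def
  proof (intro conjI ballI)
    fix x y assume xy: "x \<in> carrier L" "y \<in> carrier L"
    then have "h (x \<otimes>\<^bsub>L\<^esub> y) = h x \<otimes>\<^bsub>Pruefer p\<^esub> h y" using h by (simp add: hom_def)
    then have "pruefer_class (\<theta> (x \<otimes>\<^bsub>L\<^esub> y)) = pruefer_class (\<theta> x + \<theta> y)"
      using xy by (simp add: th(2)[symmetric] th(1) pruefer_class_mult[symmetric])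
    then show "vge 0 (\<theta> (x \<otimes>\<^bsub>L\<^esub> y) - \<theta> x - \<theta> y)"
      using xy by (simp add: pruefer_class_eq_iff th cauchy_add diff_diff_eq)
  qed (simp add: th)
  have h1: "h \<one>\<^bsub>L\<^esub> = h x \<longleftrightarrow> x \<in> V" if x: "x \<in> carrier L" for x
  proof -
    have "h \<one>\<^bsub>L\<^esub> = h x \<longleftrightarrow> V #>\<^bsub>L\<^esub> \<one>\<^bsub>L\<^esub> = V #>\<^bsub>L\<^esub> x"
      unfolding h_def
      by (rule inj_on_eq_iff[OF bij_betw_imp_inj_on[OF bij]]) (use x in \<open>simp_all only: L.rcosetsI V.subset L.one_closed\<close>)
    also have "\<dots> \<longleftrightarrow> x \<in> V"
      using x V.subset L.coset_join1[OF _ x V.subgroup_axioms] V.rcos_const[OF L]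
      by (metis L.coset_mult_one)
    finally show ?thesis .
  qed
  show thesis
  proof (rule that[OF hm])
    fix x assume x: "x \<in> carrier L"
    have "x \<in> V \<longleftrightarrow> vge 0 (\<theta> \<one>\<^bsub>L\<^esub> - \<theta> x)"
      using h1[OF x] pruefer_class_eq_iff[OF th(1) th(1), OF L.one_closed x] th(2)[OF x] th(2)[OF L.one_closed]
      by simp
    also have "\<dots> \<longleftrightarrow> vge 0 (\<theta> x)"
      unfolding vge_minus_commute[of 0 "\<theta> \<one>\<^bsub>L\<^esub>"]
      by (rule vge_cong) (simp add: hom_mod_one[OF L L.subgroup_self hm])
    finally show "vge 0 (\<theta> x) \<longleftrightarrow> x \<in> V" by simp
  next
    fix X assume X: "padic_cauchy p X"
    then have "pruefer_class X \<in> i ` (rcosets\<^bsub>L\<^esub> V)"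
      using bij by (auto simp: bij_betw_def carrier_Pruefer)
    then obtain x where x: "x \<in> carrier L" "pruefer_class X = h x"
      by (auto simp: RCOSETS_def h_def)
    then have "vge 0 (\<theta> x - X)" using X th[OF x(1)] pruefer_class_eq_iff[of "\<theta> x" X] by simp
    then show "\<exists>x\<in>carrier L. vge 0 (\<theta> x - X)" using x(1) by blast
  qed
qed


subsection \<open>Lifts and chains of subgroups\<close>

text \<open>A rational \<open>q j\<close> within p^j Z_p of each \<open>b j\<close> is chosen, and
  the sequence of these rationals is itself the limit. By the ultrametric inequality the steps after
  index n never add up to more than p^(-n).\<close>

lemma padic_complete:
  assumes c: "\<And>j. padic_cauchy p (b j)" and step: "\<And>j. vge (int j) (b (Suc j) - b j)"
  shows "\<exists>L. padic_cauchy p L \<and> (\<forall>j. vge (int j) (L - b j))"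
proof -
  have "\<exists>q. vge (int j) (b j - (\<lambda>_. q))" for j
    using c[of j] unfolding padic_cauchy_vge eventually_sequentially by blast
  then obtain q where q: "\<And>j. vge (int j) (b j - (\<lambda>_. q j))" by metis
  have near: "padic_abs p (q (n + d) - q n) \<le> P powi (- int n)" for n d
  proof (induction d)
    case (Suc d)
    have "vge (int (n + d)) ((b (Suc (n + d)) - b (n + d)) - (b (Suc (n + d)) - (\<lambda>_. q (Suc (n + d))))
        + (b (n + d) - (\<lambda>_. q (n + d))))"
      by (rule vge_add[OF vge_diff[OF step vge_mono[OF q]] q]) simp
    then have "vge (int (n + d)) ((\<lambda>_. q (Suc (n + d))) - (\<lambda>_. q (n + d)))"
      by (simp add: algebra_simps)
    then have "vge (int n) ((\<lambda>_. q (Suc (n + d))) - (\<lambda>_. q (n + d)))"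
      by (rule vge_mono) simp
    then have "padic_abs p (q (Suc (n + d)) - q (n + d)) \<le> P powi (- int n)"
      by (simp add: vge_def)
    from padic_abs_add_le[OF this Suc] show ?case by simp
  qed (simp add: less_imp_le)
  have L: "vge (int n) (q - (\<lambda>_. q n))" for n
    unfolding vge_def eventually_sequentially
    using near[of n] by (metis le_Suc_ex minus_apply)
  have "padic_cauchy p q"
    unfolding padic_cauchy_vge eventually_sequentially
  proof (intro allI exI impI)
    fix j and N assume "N \<ge> nat j"
    then show "vge j (q - (\<lambda>_. q N))" by (intro vge_mono[OF L[of N]]) simp
  qed
  moreover have "vge (int j) (q - b j)" for j
    by (rule vge_trans[OF L vge_swap[OF q]])
  ultimately show ?thesis by blast
qed

text \<open>Unboundedness provides \<open>u\<close> such that F(u) has valuation at most a lower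
  bound \<open>l\<close> for that of \<open>X\<close>. Then natural multiples of F(u), which are the
  values at powers of \<open>u\<close>, approximate \<open>X\<close>.\<close>

lemma unbounded_hom_dense:
  fixes G :: "('a, 'b) monoid_scheme" (structure)
  assumes G: "group G" and K: "subgroup K G" and F: "\<And>j. hom_mod j G K F"
    and unb: "\<And>j. \<exists>x\<in>K. \<not> vge j (F x)" and X: "padic_cauchy p X"
  shows "\<exists>x\<in>K. vge j (F x - X)"
proof -
  obtain l where l: "vge l X" using cauchy_bounded[OF X] by blast
  obtain u where u: "u \<in> K" "\<not> vge (l + 1) (F u)" using unb by blast
  obtain n where n: "vge j (X - scl (of_nat n) (F u))"
    using approx_nat_multiple[OF X hom_modD(1)[OF F u(1)] l u(2)] by blast
  have "vge j (F (u [^] n) - X)"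
    using vge_trans[OF hom_mod_pow[OF G K F u(1)]] n by (simp add: vge_minus_commute)
  then show ?thesis using pow_in_subgroup[OF G K F u(1)] by blast
qed

text \<open>The image of \<open>F\<close> is dense, hence p^(-j) F maps onto Q_p/Z_p with kernel
  \<open>U j\<close>.\<close>

lemma lift_imp_chain:
  fixes G :: "('a, 'b) monoid_scheme" (structure)
  assumes TG: "topological_group G T" and K: "subgroup K G" and openK: "openin T K"
    and F: "rep_cont_hom G T K F" and unb: "\<And>j. \<exists>x\<in>K. \<not> vge j (F x)"
  defines "U \<equiv> \<lambda>j. {x \<in> K. vge (int j) (F x)}"
  shows "openin T (U j)" "U j \<lhd> G\<lparr>carrier := K\<rparr>" "(G\<lparr>carrier := K\<rparr> Mod U j) \<cong> Pruefer p" "U (Suc j) \<subset> U j"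
proof -
  interpret group G using TG by (simp add: topological_group_def)
  have hm: "hom_mod i G K F" for i using F by (simp add: rep_cont_hom_def)
  note dense = unbounded_hom_dense[OF group_axioms K hm unb]
  show "openin T (U j)"
  proof -
    obtain V where V: "openin T V" "\<one> \<in> V" "\<forall>y\<in>V \<inter> K. vge (int j) (F y)"
      using F unfolding rep_cont_hom_def by blast
    show ?thesis
    proof (rule topological_group_open_subgroup[OF TG])
      show "subgroup (U j) G" unfolding U_def by (rule hom_mod_kernel_subgroup[OF group_axioms K hm])
      show "openin T (V \<inter> K)" using V openK by blast
    qed (use V subgroup.one_closed[OF K] in \<open>auto simp: U_def\<close>)
  qed
  show "U j \<lhd> G\<lparr>carrier := K\<rparr>"
    unfolding U_def by (rule hom_mod_kernel_normal[OF group_axioms K hm])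
  show "(G\<lparr>carrier := K\<rparr> Mod U j) \<cong> Pruefer p"
  proof -
    let ?th = "\<lambda>x. scl (Q powi (- int j)) (F x)"
    have "hom_mod 0 (G\<lparr>carrier := K\<rparr>) (carrier (G\<lparr>carrier := K\<rparr>)) ?th"
      using hom_mod_scl[OF hm[of "int j"], of "- int j"] by simp
    moreover have "\<exists>x\<in>carrier (G\<lparr>carrier := K\<rparr>). vge 0 (?th x - X)" if X: "padic_cauchy p X" for X
    proof -
      obtain x where x: "x \<in> K" "vge (int j) (F x - scl (Q powi int j) X)"
        using dense[OF cauchy_scl[OF X]] by blast
      have "vge 0 (scl (Q powi (- int j)) (F x - scl (Q powi int j) X))" using x(2) by simp
      moreover have "scl (Q powi (- int j)) (scl (Q powi int j) X) = X"
        by (simp add: scl_scl power_int_minus)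
      ultimately show ?thesis using x(1) by (auto simp: scl_diff)
    qed
    ultimately have "(G\<lparr>carrier := K\<rparr> Mod {x \<in> carrier (G\<lparr>carrier := K\<rparr>). vge 0 (?th x)}) \<cong> Pruefer p"
      by (rule iso_PrueferI[OF subgroup.subgroup_is_group[OF K group_axioms]])
    then show ?thesis by (simp add: U_def)
  qed
  show "U (Suc j) \<subset> U j"
  proof -
    \<comment> \<open>Precision \<open>j + 1\<close> around p^j forces F(x) to have valuation
      exactly \<open>j\<close>, which separates the two sets.\<close>
    obtain x where x: "x \<in> K" "vge (int j + 1) (F x - (\<lambda>_. Q powi int j))"
      using dense[OF cauchy_const] by blast
    have "vge i (\<lambda>_. Q powi int j) \<longleftrightarrow> i \<le> int j" for i
      using p_powi_le_iff[of "- int j" "- i"] by (simp add: vge_def padic_abs_powi del: p_powi_le_iff power_int_of_nat)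
    then have "vge (int j) (F x)" "\<not> vge (int (Suc j)) (F x)"
      using vge_cong[OF vge_mono[OF x(2)], of "int j"] vge_cong[OF x(2)] by (auto simp: add.commute)
    then show ?thesis using x(1) by (auto simp: U_def intro: vge_mono)
  qed
qed

text \<open>Below, \<open>\<theta> j\<close> is the projection from \<open>K\<close> to the Pruefer group with kernel \<open>V j\<close>.
  If \<open>u\<close> lies outside \<open>V (j - d)\<close>, then by induction its image under \<open>\<theta> j\<close> has order at least
  \<open>p\<^sup>d\<^sup>+\<^sup>1\<close>, so its multiples exhaust the \<open>p\<^sup>d\<^sup>+\<^sup>1\<close>-torsion; this is the step of \<open>torsion\<close>.\<close>

lemma chain_imp_lift:
  fixes G :: "('a, 'b) monoid_scheme" (structure)
  assumes TG: "topological_group G T" and K: "subgroup K G" and phi: "hom_mod 0 G K \<phi>"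
    and V0: "V 0 = {x \<in> K. vge 0 (\<phi> x)}" and dec: "\<And>j. V (Suc j) \<subset> V j"
    and openV: "\<And>j. openin T (V j)" and normal: "\<And>j. V j \<lhd> G\<lparr>carrier := K\<rparr>"
    and iso: "\<And>j. (G\<lparr>carrier := K\<rparr> Mod V j) \<cong> Pruefer p"
  shows "\<exists>F. rep_cont_hom G T K F \<and> (\<forall>x\<in>K. vge 0 (\<phi> x - F x))"
proof -
  interpret group G using TG by (simp add: topological_group_def)
  interpret K: subgroup K G by (rule K)
  have "\<exists>\<theta>. hom_mod 0 G K \<theta> \<and> (\<forall>x\<in>K. vge 0 (\<theta> x) \<longleftrightarrow> x \<in> V j) \<and>
      (\<forall>X. padic_cauchy p X \<longrightarrow> (\<exists>x\<in>K. vge 0 (\<theta> x - X)))" for j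
    using iso_PrueferE[OF K.subgroup_is_group[OF group_axioms] normal iso, of j] by simp metis
  then obtain \<theta> where th: "\<And>j. hom_mod 0 G K (\<theta> j)"
    and thV: "\<And>j x. x \<in> K \<Longrightarrow> vge 0 (\<theta> j x) \<longleftrightarrow> x \<in> V j"
    and surj: "\<And>j X. padic_cauchy p X \<Longrightarrow> \<exists>x\<in>K. vge 0 (\<theta> j x - X)"
    by metis
  have VG: "subgroup (V j) G" for j
    using normal_imp_subgroup[OF normal] incl_subgroup[OF K] by blast
  have VK: "V j \<subseteq> K" for j
    using subgroup.subset[OF normal_imp_subgroup[OF normal[of j]]] by simp
  have anti: "V j \<subseteq> V i" if "i \<le> j" for i j
    by (rule lift_Suc_antimono_le[OF _ that]) (use dec in blast)
  note pow = pow_in_subgroup[OF group_axioms K phi]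
  \<comment> \<open>Agreement of \<open>x\<close> and \<open>y [^] n\<close> modulo
    \<open>V j\<close> becomes a congruence between values of \<open>\<theta> j\<close>.\<close>
  have key: "x \<otimes> inv (y [^] n) \<in> V j \<longleftrightarrow> vge 0 (\<theta> j x - scl (of_nat n) (\<theta> j y))"
    if x: "x \<in> K" and y: "y \<in> K" for x y j and n :: nat
  proof -
    have "vge 0 ((\<theta> j (x \<otimes> inv (y [^] n)) - (\<theta> j x - \<theta> j (y [^] n))) - (\<theta> j (y [^] n) - scl (of_nat n) (\<theta> j y)))"
      by (rule vge_diff[OF hom_mod_mult_inv[OF group_axioms K th x pow[OF y]] hom_mod_pow[OF group_axioms K th y]])
    then have "vge 0 (\<theta> j (x \<otimes> inv (y [^] n)) - (\<theta> j x - scl (of_nat n) (\<theta> j y)))"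
      by (simp add: algebra_simps)
    from vge_cong[OF this] show ?thesis using thV[of "x \<otimes> inv (y [^] n)" j] x y pow by simp
  qed
  have torsion: "z \<in> V (j - d)" if "d \<le> j" "z \<in> K" "vge (- int d) (\<theta> j z)" for d j z
    using that
  proof (induction d arbitrary: z)
    case 0
    then show ?case using thV by simp
  next
    case (Suc d)
    obtain u where u: "u \<in> V (j - Suc d)" "u \<notin> V (j - d)"
      using dec[of "j - Suc d"] Suc.prems(1) by (metis Suc_diff_Suc Suc_le_lessD psubset_imp_ex_mem DiffE)
    have uK: "u \<in> K" using u VK by blast
    have "\<not> vge (- int (Suc d) + 1) (\<theta> j u)" using Suc.IH[OF _ uK] u Suc.prems(1) by auto
    then obtain n where n: "vge 0 (\<theta> j z - scl (of_nat n) (\<theta> j u))"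
      using approx_nat_multiple[OF hom_modD(1)[OF th Suc.prems(2)] hom_modD(1)[OF th uK] Suc.prems(3)] by blast
    then have "z \<otimes> inv (u [^] n) \<in> V (j - Suc d)"
      using key[OF Suc.prems(2) uK, of n j] anti[of "j - Suc d" j] by auto
    moreover have "u [^] n \<in> V (j - Suc d)"
      by (rule pow_in_subgroup[OF group_axioms VG hom_mod_subset[OF phi VK] u(1)])
    ultimately have "z \<otimes> inv (u [^] n) \<otimes> u [^] n \<in> V (j - Suc d)"
      by (rule subgroup.m_closed[OF VG])
    then show ?case using Suc.prems(2) pow[OF uK, of n] by (simp add: m_assoc)
  qed
  define root where "root j x y \<longleftrightarrow> y \<in> K \<and> x \<otimes> inv (y [^] (p ^ j)) \<in> V j" for j x y
  have root_ex: "\<exists>y. root j x y" if x: "x \<in> K" for j x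
  proof -
    \<comment> \<open>Divisibility of the Pruefer group: \<open>\<theta> j x\<close> divided by p^j
      is attained modulo Z_p.\<close>
    obtain y where y: "y \<in> K" "vge 0 (\<theta> j y - scl (Q powi (- int j)) (\<theta> j x))"
      using surj[OF cauchy_scl[OF hom_modD(1)[OF th x]]] by blast
    have "scl (of_nat (p ^ j)) (scl (Q powi (- int j)) (\<theta> j x)) = \<theta> j x"
      by (simp add: scl_scl power_int_minus)
    then have "vge 0 (scl (of_nat (p ^ j)) (\<theta> j y) - \<theta> j x)"
      using vge_scl_nat[OF y(2), of "p ^ j"] by (simp add: scl_diff)
    then show ?thesis using key[OF x y(1)] y(1) by (auto simp: root_def vge_minus_commute)
  qed
  \<comment> \<open>Two roots differ by p^j-torsion modulo \<open>V j\<close>;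
    \<open>torsion\<close> with \<open>d = j\<close> places this difference in \<open>V 0\<close>,
    where \<phi> is integral.\<close>
  have root_unique: "vge 0 (\<phi> y - \<phi> y')" if x: "x \<in> K" and r: "root j x y" "root j x y'" for j x y y'
  proof -
    have y: "y \<in> K" "y' \<in> K" using r by (auto simp: root_def)
    have "vge 0 ((\<theta> j x - scl (of_nat (p ^ j)) (\<theta> j y')) - (\<theta> j x - scl (of_nat (p ^ j)) (\<theta> j y)))"
      by (rule vge_diff) (use r key[OF x y(1)] key[OF x y(2)] in \<open>simp_all add: root_def\<close>)
    then have "vge 0 (scl (Q powi int j) (\<theta> j y - \<theta> j y'))"
      by (simp add: scl_diff)
    then have "vge (- int j) (\<theta> j y - \<theta> j y')" by simp
    then have "vge (- int j) (\<theta> j (y \<otimes> inv y'))"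
      using vge_cong[OF vge_mono[OF hom_mod_mult_inv[OF group_axioms K th y]], of "- int j"] by simp
    then have "y \<otimes> inv y' \<in> V 0" using torsion[of j j "y \<otimes> inv y'"] y by simp
    then show ?thesis using vge_cong[OF hom_mod_mult_inv[OF group_axioms K phi y]] by (simp add: V0)
  qed
  have root_mult: "root j (x \<otimes> x') (y \<otimes> y')"
    if x: "x \<in> K" "x' \<in> K" and r: "root j x y" "root j x' y'" for j x x' y y'
  proof -
    have y: "y \<in> K" "y' \<in> K" using r by (auto simp: root_def)
    have "vge 0 ((\<theta> j (x \<otimes> x') - \<theta> j x - \<theta> j x') - scl (of_nat (p ^ j)) (\<theta> j (y \<otimes> y') - \<theta> j y - \<theta> j y')
      + (\<theta> j x - scl (of_nat (p ^ j)) (\<theta> j y)) + (\<theta> j x' - scl (of_nat (p ^ j)) (\<theta> j y')))"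
      by (rule vge_add[OF vge_add[OF vge_diff[OF hom_modD(2)[OF th x] vge_scl_nat[OF hom_modD(2)[OF th y]]]]])
        (use r key[OF x(1) y(1)] key[OF x(2) y(2)] in \<open>simp_all add: root_def\<close>)
    then have "vge 0 (\<theta> j (x \<otimes> x') - scl (of_nat (p ^ j)) (\<theta> j (y \<otimes> y')))"
      by (simp add: scl_diff scl_add algebra_simps)
    then show ?thesis using key[of "x \<otimes> x'" "y \<otimes> y'"] x y by (simp add: root_def)
  qed
  \<comment> \<open>The p-th power of a root at level j+1 is a root at level j, because
    \<open>V (Suc j)\<close> lies in \<open>V j\<close>. This links consecutive
    approximations.\<close>
  have root_Suc: "root j x (y [^] p)" if "root (Suc j) x y" for j x y
    using that dec[of j] pow by (auto simp: root_def nat_pow_pow)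
  define y where "y j x = (SOME y. root j x y)" for j x
  have y: "root j x (y j x)" if "x \<in> K" for j x
    unfolding y_def by (rule someI_ex[OF root_ex[OF that]])
  have yK: "y j x \<in> K" if "x \<in> K" for j x using y[OF that] by (simp add: root_def)
  \<comment> \<open>\<phi> is determined modulo Z_p on roots, so after scaling these values are
    determined modulo p^j Z_p.\<close>
  define b where "b x j = scl (Q ^ j) (\<phi> (y j x))" for x j
  have b_cong: "vge (int j) (b x j - scl (Q ^ j) (\<phi> z))" if "x \<in> K" "root j x z" for j x z
    unfolding b_def scl_diff[symmetric] using root_unique[OF that(1) y[OF that(1)] that(2)] by simp
  have "\<exists>L. padic_cauchy p L \<and> (\<forall>j. vge (int j) (L - b x j))" if x: "x \<in> K" for x
  proof (rule padic_complete)
    show "padic_cauchy p (b x j)" for j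
      unfolding b_def by (rule cauchy_scl[OF hom_modD(1)[OF phi yK[OF x]]])
    fix j
    let ?z = "y (Suc j) x"
    have "vge (int j) (b x j - scl (Q ^ j) (\<phi> (?z [^] p)))"
      by (rule b_cong[OF x root_Suc[OF y[OF x]]])
    moreover have "vge (int j) (scl (Q ^ j) (\<phi> (?z [^] p) - scl (of_nat p) (\<phi> ?z)))"
      using hom_mod_pow[OF group_axioms K phi yK[OF x]] by simp
    moreover have "scl (Q ^ j) (scl (of_nat p) (\<phi> ?z)) = b x (Suc j)"
      by (simp add: b_def scl_scl mult.commute)
    ultimately show "vge (int j) (b x (Suc j) - b x j)"
      by (simp add: scl_diff) (metis vge_minus_commute vge_trans)
  qed
  then obtain F where Fc: "\<And>x. x \<in> K \<Longrightarrow> padic_cauchy p (F x)"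
    and Fb: "\<And>x j. x \<in> K \<Longrightarrow> vge (int j) (F x - b x j)"
    by metis
  have F_root: "vge (int j) (F x - scl (Q ^ j) (\<phi> z))" if "x \<in> K" "root j x z" for j x z
    by (rule vge_trans[OF Fb[OF that(1)] b_cong[OF that]])
  have "hom_mod i G K F" for i
  \<comment> \<open>Approximations are indexed by natural numbers; a negative \<open>i\<close> is
    served by level 0, which is stronger.\<close>
  proof (rule hom_mod_mono)
    show "hom_mod (int (nat i)) G K F"
      unfolding hom_mod_def
    proof (intro conjI ballI Fc)
      fix x x' assume x: "x \<in> K" "x' \<in> K"
      let ?j = "nat i" and ?z = "y (nat i) x" and ?z' = "y (nat i) x'"
      let ?s = "scl (Q ^ ?j)"
      have z: "?z \<in> K" "?z' \<in> K" using x yK by auto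
      have "vge (int ?j) ((F (x \<otimes> x') - ?s (\<phi> (?z \<otimes> ?z'))) - (F x - ?s (\<phi> ?z)) - (F x' - ?s (\<phi> ?z'))
          + ?s (\<phi> (?z \<otimes> ?z') - \<phi> ?z - \<phi> ?z'))"
        by (rule vge_add[OF vge_diff[OF vge_diff[OF F_root F_root] F_root]])
          (use x y root_mult[OF x] hom_modD(2)[OF phi z] in simp_all)
      then show "vge (int ?j) (F (x \<otimes> x') - F x - F x')"
        by (simp add: scl_diff scl_add algebra_simps)
    qed
  qed simp
  moreover have "\<exists>W. openin T W \<and> \<one> \<in> W \<and> (\<forall>x\<in>W \<inter> K. vge i (F x))" for i
  proof (intro exI conjI ballI)
    show "openin T (V (nat i))" "\<one> \<in> V (nat i)" using openV subgroup.one_closed[OF VG] by auto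
    fix x assume x: "x \<in> V (nat i) \<inter> K"
    \<comment> \<open>On \<open>V j\<close> the identity is a root, so F(x) agrees with p^j
      \<phi>(1) modulo p^j Z_p, and \<phi>(1) is integral.\<close>
    then have "root (nat i) x \<one>" by (simp add: root_def)
    then have "vge (int (nat i)) (F x - scl (Q ^ nat i) (\<phi> \<one>))" using F_root x by blast
    moreover have "vge (int (nat i)) (scl (Q ^ nat i) (\<phi> \<one>))"
      using hom_mod_one[OF group_axioms K phi] by simp
    ultimately have "vge (int (nat i)) (F x)" using vge_cong by blast
    then show "vge i (F x)" by (rule vge_mono) simp
  qed
  moreover have "vge 0 (\<phi> x - F x)" if x: "x \<in> K" for x
  proof -
    \<comment> \<open>At level 0 the exponent p^0 is 1, so \<open>x\<close> is its own root and F(x)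
      agrees with \<phi>(x) modulo Z_p.\<close>
    have "root 0 x x" using x subgroup.one_closed[OF VG] by (simp add: root_def)
    then show ?thesis using F_root[OF x, of 0 x] by (simp add: vge_minus_commute)
  qed
  ultimately show ?thesis unfolding rep_cont_hom_def by blast
qed

end


section \<open>Lifts compared with chains and with the distance to homomorphisms\<close>

text \<open>\<open>g N\<close> is a later index at which the chain has dropped below
  \<open>Us N\<close>. Iterating \<open>g\<close> from 0 keeps the initial set and makes every step
  strict.\<close>

lemma strict_subchain:
  fixes Us :: "nat \<Rightarrow> 'a set"
  assumes dec: "\<And>j. Us (Suc j) \<subseteq> Us j" and ns: "\<not> (\<exists>N. \<forall>j\<ge>N. Us j = Us N)"
  obtains s where "s 0 = 0" "\<And>n. Us (s (Suc n)) \<subset> Us (s n)"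
proof -
  obtain g where g: "\<And>N. g N \<ge> N" "\<And>N. Us (g N) \<noteq> Us N" using ns by metis
  have "Us (g N) \<subset> Us N" for N
    using lift_Suc_antimono_le[of Us, OF dec g(1)] g(2) by blast
  then show thesis by (intro that[of "\<lambda>n. (g ^^ n) 0"]) simp_all
qed

context padic
begin

lemma rep_cont_hom_subset:
  assumes "rep_cont_hom G T K F" "L \<subseteq> K"
  shows "rep_cont_hom G T L F"
  unfolding rep_cont_hom_def
proof (intro conjI allI)
  show "hom_mod j G L F" for j
    using assms(1) by (intro hom_mod_subset[OF _ assms(2)]) (simp add: rep_cont_hom_def)
  fix j
  obtain V where "openin T V" "\<one>\<^bsub>G\<^esub> \<in> V" "\<forall>y\<in>V \<inter> K. vge j (F y)"
    using assms(1) unfolding rep_cont_hom_def by blast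
  then show "\<exists>V. openin T V \<and> \<one>\<^bsub>G\<^esub> \<in> V \<and> (\<forall>y\<in>V \<inter> L. vge j (F y))"
    using assms(2) by (intro exI[of _ V]) auto
qed

text \<open>A bound on \<open>K\<close> would give one on each coset \<open>K #> a\<close>,
  depending on the valuation of \<phi>(a), and finitely many cosets would give a bound on the whole
  group.\<close>

lemma unbounded_finite_index:
  fixes G :: "('a, 'b) monoid_scheme" (structure)
  assumes G: "group G" and K: "subgroup K G" and fin: "finite (rcosets K)"
    and phi: "hom_mod 0 G (carrier G) \<phi>" and unb: "\<And>j. \<exists>g\<in>carrier G. \<not> vge j (\<phi> g)"
  shows "\<exists>x\<in>K. \<not> vge j (\<phi> x)"
proof (rule ccontr)
  assume "\<not> ?thesis"
  then have bd: "vge j (\<phi> x)" if "x \<in> K" for x using that by blast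
  interpret group G by (rule G)
  interpret K: subgroup K G by (rule K)
  have "\<exists>l. \<forall>g\<in>C. vge l (\<phi> g)" if C: "C \<in> rcosets K" for C
  proof -
    obtain a where a: "a \<in> carrier G" "C = K #> a" using C by (auto simp: RCOSETS_def)
    obtain i where i: "vge i (\<phi> a)" using cauchy_bounded[OF hom_modD(1)[OF phi a(1)]] by blast
    \<comment> \<open>The entry 0 accounts for \<phi> being additive only modulo Z_p.\<close>
    let ?l = "min 0 (min j i)"
    have "vge ?l (\<phi> (x \<otimes> a))" if x: "x \<in> K" for x
    proof -
      have "vge ?l ((\<phi> (x \<otimes> a) - \<phi> x - \<phi> a) + (\<phi> x + \<phi> a))"
        using x a
        by (intro vge_add[OF vge_mono[OF hom_modD(2)[OF phi]] vge_add[OF vge_mono[OF bd] vge_mono[OF i]]]) auto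
      then show ?thesis by simp
    qed
    then show ?thesis using a(2) by (auto simp: r_coset_def)
  qed
  then obtain l where l: "\<And>C g. C \<in> rcosets K \<Longrightarrow> g \<in> C \<Longrightarrow> vge (l C) (\<phi> g)" by metis
  obtain g where g: "g \<in> carrier G" "\<not> vge (Min (l ` (rcosets K))) (\<phi> g)" using unb by blast
  have "K #> g \<in> rcosets K" using g by (simp add: rcosetsI K.subset)
  moreover have "g \<in> K #> g" using rcos_self[OF g(1) K] .
  ultimately show False using g(2) vge_mono[OF l] fin by (meson Min_le finite_imageI imageI)
qed

text \<open>A lift inherits unboundedness on \<open>K\<close> from \<phi> and so yields a chain. A
  chain that never stabilizes is first thinned out to a strict one, from which the lift is
  built.\<close>

lemma lift_iff_chain:
  fixes G :: "('a, 'b) monoid_scheme" (structure)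
  assumes TG: "topological_group G T" and K: "subgroup K G" and openK: "openin T K"
    and fin: "finite (rcosets K)" and phi: "hom_mod 0 G (carrier G) \<phi>"
    and unb: "\<And>j. \<exists>g\<in>carrier G. \<not> vge j (\<phi> g)"
  shows "(\<exists>F. rep_cont_hom G T K F \<and> (\<forall>x\<in>K. vge 0 (\<phi> x - F x))) \<longleftrightarrow>
    (\<exists>Us :: nat \<Rightarrow> 'a set. Us 0 = {x \<in> K. vge 0 (\<phi> x)} \<and> (\<forall>j. Us (Suc j) \<subseteq> Us j) \<and>
      (\<forall>j. openin T (Us j) \<and> Us j \<lhd> G\<lparr>carrier := K\<rparr> \<and> (G\<lparr>carrier := K\<rparr> Mod Us j) \<cong> Pruefer p) \<and>
      \<not> (\<exists>N. \<forall>j\<ge>N. Us j = Us N))"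
    (is "?lift \<longleftrightarrow> (\<exists>Us. ?chain Us)")
proof
  assume ?lift
  then obtain F where F: "rep_cont_hom G T K F" and lift: "\<forall>x\<in>K. vge 0 (\<phi> x - F x)" by blast
  have G: "group G" using TG by (simp add: topological_group_def)
  have unbF: "\<exists>x\<in>K. \<not> vge j (F x)" for j
  proof -
    \<comment> \<open>The level is capped at 0 since \<open>F\<close> and \<phi> agree only modulo
      Z_p.\<close>
    obtain x where x: "x \<in> K" "\<not> vge (min 0 j) (\<phi> x)"
      using unbounded_finite_index[OF G K fin phi unb] by blast
    have "vge (min 0 j) (\<phi> x - F x)" using lift x(1) vge_mono[of 0 _ "min 0 j"] by simp
    then have "\<not> vge (min 0 j) (F x)" using vge_cong x(2) by blast
    then show ?thesis using x(1) vge_mono[of j _ "min 0 j"] by auto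
  qed
  note ch = lift_imp_chain[OF TG K openK F unbF]
  let ?U = "\<lambda>j. {x \<in> K. vge (int j) (F x)}"
  have "?U 0 = {x \<in> K. vge 0 (\<phi> x)}" using vge_cong lift by auto
  moreover have "\<not> (\<exists>N. \<forall>j\<ge>N. ?U j = ?U N)"
  proof
    assume "\<exists>N. \<forall>j\<ge>N. ?U j = ?U N"
    then obtain N where "?U (Suc N) = ?U N" by (meson le_SucI order_refl)
    then show False using ch(4)[of N] by blast
  qed
  ultimately show "\<exists>Us. ?chain Us"
    by (intro exI[of _ ?U] conjI allI ch(1-3) psubset_imp_subset[OF ch(4)])
next
  assume "\<exists>Us. ?chain Us"
  then obtain Us where Us: "Us 0 = {x \<in> K. vge 0 (\<phi> x)}" "\<And>j. Us (Suc j) \<subseteq> Us j"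
    "\<And>j. openin T (Us j)" "\<And>j. Us j \<lhd> G\<lparr>carrier := K\<rparr>" "\<And>j. (G\<lparr>carrier := K\<rparr> Mod Us j) \<cong> Pruefer p"
    and ns: "\<not> (\<exists>N. \<forall>j\<ge>N. Us j = Us N)"
    by blast
  obtain s where s: "s 0 = 0" "\<And>n. Us (s (Suc n)) \<subset> Us (s n)" using strict_subchain[of Us, OF Us(2) ns] by metis
  show ?lift
    by (rule chain_imp_lift[OF TG K hom_mod_subset[OF phi subgroup.subset[OF K]], of "\<lambda>n. Us (s n)"])
      (use Us s in simp_all)
qed

text \<open>If the infimum is at most p^k, some homomorphism has supremum below p^(k+1). Absolute
  values being powers of p, each of its distances is then at most p^k, so the bound is reached by
  one homomorphism.\<close>

lemma dist_hom_gt_iff: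
  assumes TG: "topological_group G T" and f: "\<And>g. g \<in> carrier G \<Longrightarrow> f g \<in> Qp p"
  shows "ereal (P ^ k) < dist_hom p G T f \<longleftrightarrow>
    \<not> (\<exists>H. rep_cont_hom G T (carrier G) H \<and> (\<forall>g\<in>carrier G. vge (- int k) (qp_rep (f g) - H g)))"
proof -
  interpret group G using TG by (simp add: topological_group_def)
  let ?S = "\<lambda>h. SUP g\<in>carrier G. ereal (qp_abs p (qp_sub p (f g) (h g)))"
  let ?H = "{h. qp_cont_hom p G T (carrier G) h}"
  have "dist_hom p G T f \<le> ereal (P ^ k) \<longleftrightarrow>
    (\<exists>h. qp_cont_hom p G T (carrier G) h \<and> (\<forall>g\<in>carrier G. vge (- int k) (qp_rep (qp_sub p (f g) (h g)))))"
    (is "_ \<longleftrightarrow> ?R")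
  proof
    assume "dist_hom p G T f \<le> ereal (P ^ k)"
    also have "P powi int k < P powi (1 - (- int k))" by (subst p_powi_less_iff) simp
    then have "ereal (P ^ k) < ereal (P powi (1 - (- int k)))" by simp
    finally obtain h where h: "h \<in> ?H" "?S h < ereal (P powi (1 - (- int k)))"
      unfolding dist_hom_def by (auto simp: INF_less_iff)
    have "vge (- int k) (qp_rep (qp_sub p (f g) (h g)))" if g: "g \<in> carrier G" for g
    proof -
      have "h g \<in> Qp p" using h(1) g by (simp add: qp_cont_hom_def qp_continuous_on_def)
      moreover have "ereal (qp_abs p (qp_sub p (f g) (h g))) \<le> ?S h" by (rule SUP_upper[OF g])
      then have "ereal (qp_abs p (qp_sub p (f g) (h g))) < ereal (P powi (1 - (- int k)))"
        using h(2) by (rule order_le_less_trans)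
      ultimately show ?thesis
        using qp_abs_less_iff[OF qp_sub_closed[OF f[OF g]], of "h g" "- int k"] by simp
    qed
    then show ?R using h(1) by blast
  next
    assume ?R
    then obtain h where h: "h \<in> ?H" "\<forall>g\<in>carrier G. vge (- int k) (qp_rep (qp_sub p (f g) (h g)))" by blast
    have "?S h \<le> ereal (P ^ k)"
    proof (rule SUP_least)
      fix g assume g: "g \<in> carrier G"
      then have "h g \<in> Qp p" using h(1) by (simp add: qp_cont_hom_def qp_continuous_on_def)
      then show "ereal (qp_abs p (qp_sub p (f g) (h g))) \<le> ereal (P ^ k)"
        using qp_abs_le_iff[OF qp_sub_closed[OF f[OF g]], of "h g" "- int k"] h(2) g by simp
    qed
    then show "dist_hom p G T f \<le> ereal (P ^ k)"
      unfolding dist_hom_def using h(1) by (rule INF_lower2[rotated])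
  qed
  then show ?thesis
    using ex_qp_cont_hom_iff[OF TG subgroup_self, of f "- int k"] f by (simp add: not_le[symmetric])
qed

text \<open>Boundedness of the defect set makes its supremum an upper bound, and a defect of at most
  1 means that the failure of additivity lies in Z_p.\<close>

lemma quasimorphism_hom_mod:
  assumes "group G" "qp_quasimorphism p G f" "defect p G f = 1"
  shows "hom_mod 0 G (carrier G) (\<lambda>g. qp_rep (f g))"
  unfolding hom_mod_def
proof (intro conjI ballI)
  have fQ: "f g \<in> Qp p" if "g \<in> carrier G" for g using assms(2) that by (simp add: qp_quasimorphism_def)
  then show "padic_cauchy p (qp_rep (f x))" if "x \<in> carrier G" for x using that rep_cauchy by blast
  fix g h assume gh: "g \<in> carrier G" "h \<in> carrier G"
  let ?A = "f (g \<otimes>\<^bsub>G\<^esub> h)"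
  have Q: "?A \<in> Qp p" "f g \<in> Qp p" "f h \<in> Qp p"
    using gh fQ assms(1) by (simp_all add: group.is_monoid monoid.m_closed)
  let ?d = "qp_sub p (qp_sub p ?A (f g)) (f h)"
  have "qp_abs p ?d \<in> defect_set p G f" using gh by (auto simp: defect_set_def)
  then have "qp_abs p ?d \<le> 1"
    using assms(2,3) cSup_upper[of _ "defect_set p G f"] by (simp add: qp_quasimorphism_def defect_def)
  then have "vge 0 (qp_rep (qp_sub p ?A (f g)) - qp_rep (f h))"
    using qp_abs_le_iff[of ?d 0] Q by (simp add: qp_sub_closed vge_rep_sub)
  moreover have "vge 0 (qp_rep (qp_sub p ?A (f g)) - (qp_rep ?A - qp_rep (f g)))"
    unfolding qp_sub_alt by (rule rep_class(2)) (simp add: Q rep_cauchy cauchy_diff)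
  ultimately have "vge 0 ((qp_rep (qp_sub p ?A (f g)) - qp_rep (f h))
     - (qp_rep (qp_sub p ?A (f g)) - (qp_rep ?A - qp_rep (f g))))"
    by (rule vge_diff)
  then show "vge 0 (qp_rep ?A - qp_rep (f g) - qp_rep (f h))" by (simp add: algebra_simps)
qed

end

section \<open>Reduction of all equivalences to the existence of lifts\<close>

theorem theorem9p28:
  fixes p :: nat and G :: "('a, 'b) monoid_scheme" and T :: "'a topology"
    and f :: "'a \<Rightarrow> (nat \<Rightarrow> rat) set" and k :: nat
  assumes "prime p"
    and "topological_group G T"
    and "qp_quasimorphism p G f"
    and "qp_continuous_on p T (carrier G) f"
    and "\<not> qp_bounded p G f"
    and "defect p G f = 1"
  defines "U \<equiv> {g \<in> carrier G. f g \<in> Zp p}"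
  shows
   "(dist_hom p G T f > ereal (real p ^ k)
      \<longleftrightarrow> (\<forall>K. subgroup K G \<and> openin T K \<and> finite (rcosets\<^bsub>G\<^esub> K) \<and> card (rcosets\<^bsub>G\<^esub> K) \<le> p ^ k
             \<longrightarrow> \<not> (\<exists>h. qp_cont_hom p G T K h \<and> (\<forall>x\<in>K. qp_sub p (f x) (h x) \<in> Zp p)))) \<and>
    (dist_hom p G T f > ereal (real p ^ k)
      \<longleftrightarrow> (\<forall>K. subgroup K G \<and> openin T K \<and> finite (rcosets\<^bsub>G\<^esub> K) \<and> card (rcosets\<^bsub>G\<^esub> K) \<le> p ^ k
             \<longrightarrow> (\<forall>Us :: nat \<Rightarrow> 'a set. Us 0 = U \<inter> K \<and> (\<forall>j. Us (Suc j) \<subseteq> Us j) \<and>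
                    (\<forall>j. openin T (Us j) \<and> normal (Us j) (G\<lparr>carrier := K\<rparr>) \<and>
                         (G\<lparr>carrier := K\<rparr> Mod Us j) \<cong> Pruefer p)
                  \<longrightarrow> (\<exists>N. \<forall>j\<ge>N. Us j = Us N)))) \<and>
    (dist_hom p G T f > ereal (real p ^ k)
      \<longleftrightarrow> (\<forall>K. K \<lhd> G \<and> openin T K \<and> finite (rcosets\<^bsub>G\<^esub> K) \<and> card (rcosets\<^bsub>G\<^esub> K) dvd p ^ k
             \<longrightarrow> \<not> (\<exists>h. qp_cont_hom p G T K h \<and> (\<forall>x\<in>K. qp_sub p (f x) (h x) \<in> Zp p)))) \<and>
    (dist_hom p G T f > ereal (real p ^ k)
      \<longleftrightarrow> (\<forall>K. K \<lhd> G \<and> openin T K \<and> finite (rcosets\<^bsub>G\<^esub> K) \<and> card (rcosets\<^bsub>G\<^esub> K) dvd p ^ k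
             \<longrightarrow> (\<forall>Us :: nat \<Rightarrow> 'a set. Us 0 = U \<inter> K \<and> (\<forall>j. Us (Suc j) \<subseteq> Us j) \<and>
                    (\<forall>j. openin T (Us j) \<and> normal (Us j) (G\<lparr>carrier := K\<rparr>) \<and>
                         (G\<lparr>carrier := K\<rparr> Mod Us j) \<cong> Pruefer p)
                  \<longrightarrow> (\<exists>N. \<forall>j\<ge>N. Us j = Us N))))"
proof -
  interpret padic p by (rule padic.intro[OF assms(1)])
  note TG = assms(2)
  interpret group G using TG by (simp add: topological_group_def)
  define \<phi> where "\<phi> g = qp_rep (f g)" for g
  have fQ: "f g \<in> Qp p" if "g \<in> carrier G" for g using assms(3) that by (simp add: qp_quasimorphism_def)
  have phi: "hom_mod 0 G (carrier G) \<phi>"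
    using quasimorphism_hom_mod[OF group_axioms assms(3,6)] by (simp add: \<phi>_def[abs_def])
  have unb: "\<exists>g\<in>carrier G. \<not> vge j (\<phi> g)" for j
    using assms(5) qp_abs_le_iff[OF fQ] unfolding qp_bounded_def \<phi>_def by blast
  define lift where "lift K \<longleftrightarrow> (\<exists>F. rep_cont_hom G T K F \<and> (\<forall>x\<in>K. vge 0 (\<phi> x - F x)))" for K
  define near where "near \<longleftrightarrow> (\<exists>H. rep_cont_hom G T (carrier G) H \<and> (\<forall>g\<in>carrier G. vge (- int k) (\<phi> g - H g)))"
  have dist: "dist_hom p G T f > ereal (real p ^ k) \<longleftrightarrow> \<not> near"
    using dist_hom_gt_iff[OF TG fQ] by (simp add: near_def \<phi>_def)
  \<comment> \<open>The index is positive and below p^(k+1), so p^(k+1) does not divide it and the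
    transfer applies.\<close>
  have near_if_lift: near
    if "subgroup K G" "openin T K" "finite (rcosets\<^bsub>G\<^esub> K)" "card (rcosets\<^bsub>G\<^esub> K) \<le> p ^ k" "lift K" for K
  proof -
    have "card (rcosets\<^bsub>G\<^esub> K) > 0"
      using that(3) subgroup.subgroup_in_rcosets[OF that(1) group_axioms] by (auto simp: card_gt_0_iff)
    moreover have "card (rcosets\<^bsub>G\<^esub> K) < p ^ Suc k"
      using that(4) power_strict_increasing[of k "Suc k" p] p_gt_1 by linarith
    ultimately have "\<not> p ^ Suc k dvd card (rcosets\<^bsub>G\<^esub> K)" by (auto dest: dvd_imp_le)
    then show ?thesis
      using transfer_lift[OF TG that(1-3) _ phi] that(5) unfolding lift_def near_def by blast
  qed
  have lift_if_near: "\<exists>K. K \<lhd> G \<and> openin T K \<and> finite (rcosets\<^bsub>G\<^esub> K) \<and> card (rcosets\<^bsub>G\<^esub> K) dvd p ^ k \<and> lift K"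
    if n: near
  proof -
    obtain H where H: "rep_cont_hom G T (carrier G) H" "\<forall>g\<in>carrier G. vge (- int k) (\<phi> g - H g)"
      using n by (auto simp: near_def)
    \<comment> \<open>The kernel of the difference modulo Z_p: on it \<open>H\<close> is a lift of
      f, and its index divides p^k.\<close>
    define K where "K = {x \<in> carrier G. vge 0 (\<phi> x - H x)}"
    have "hom_mod 0 G (carrier G) (\<lambda>x. \<phi> x - H x)"
      using H(1) by (intro hom_mod_diff phi) (simp add: rep_cont_hom_def)
    note K = bounded_hom_mod_kernel[OF group_axioms this H(2), folded K_def]
    obtain V where V: "openin T V" "\<one>\<^bsub>G\<^esub> \<in> V" "\<forall>y\<in>V \<inter> carrier G. vge 0 (\<phi> y - \<phi> \<one>\<^bsub>G\<^esub>)"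
      using assms(4) one_closed unfolding qp_continuous_on_iff \<phi>_def by blast
    obtain W where W: "openin T W" "\<one>\<^bsub>G\<^esub> \<in> W" "\<forall>y\<in>W \<inter> carrier G. vge 0 (H y)"
      using H(1) unfolding rep_cont_hom_def by blast
    have "openin T K"
    proof (rule topological_group_open_subgroup[OF TG normal_imp_subgroup[OF K(1)]])
      have "vge 0 (\<phi> y - H y)" if "y \<in> V" "y \<in> W" "y \<in> carrier G" for y
      \<comment> \<open>Near the identity \<phi> is close to \<phi>(1), which is integral by
        additivity modulo Z_p.\<close>
      proof (rule vge_diff)
        show "vge 0 (\<phi> y)"
          using V(3) that vge_cong hom_mod_one[OF group_axioms subgroup_self phi] by blast
      qed (use W(3) that in blast)
      then show "V \<inter> W \<inter> carrier G \<subseteq> K" by (auto simp: K_def)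
    qed (use V W in auto)
    moreover have "lift K"
    proof -
      have sub: "K \<subseteq> carrier G" by (auto simp: K_def)
      have "rep_cont_hom G T K H" by (rule rep_cont_hom_subset[OF H(1) sub])
      then show ?thesis by (auto simp: lift_def K_def)
    qed
    ultimately show ?thesis using K by blast
  qed
  have lift_hom: "(\<exists>h. qp_cont_hom p G T K h \<and> (\<forall>x\<in>K. qp_sub p (f x) (h x) \<in> Zp p)) \<longleftrightarrow> lift K"
    if K: "subgroup K G" for K
  proof -
    have "f x \<in> Qp p" if "x \<in> K" for x using that fQ subgroup.subset[OF K] by blast
    moreover from this have "qp_sub p (f x) (h x) \<in> Zp p \<longleftrightarrow> vge 0 (qp_rep (qp_sub p (f x) (h x)))"
      if "qp_cont_hom p G T K h" "x \<in> K" for h x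
      using that by (simp add: Zp_iff qp_sub_closed qp_cont_hom_def qp_continuous_on_def)
    ultimately show ?thesis
      using ex_qp_cont_hom_iff[OF TG K, of f 0] unfolding lift_def \<phi>_def by blast
  qed
  \<comment> \<open>The stabilization condition is the negation of the existence of a
    non-stabilizing chain, hence of a lift.\<close>
  have lift_chain: "(\<forall>Us :: nat \<Rightarrow> 'a set. Us 0 = U \<inter> K \<and> (\<forall>j. Us (Suc j) \<subseteq> Us j) \<and>
                    (\<forall>j. openin T (Us j) \<and> normal (Us j) (G\<lparr>carrier := K\<rparr>) \<and>
                         (G\<lparr>carrier := K\<rparr> Mod Us j) \<cong> Pruefer p)
                  \<longrightarrow> (\<exists>N. \<forall>j\<ge>N. Us j = Us N)) \<longleftrightarrow> \<not> lift K"
    if K: "subgroup K G" "openin T K" "finite (rcosets\<^bsub>G\<^esub> K)" for K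
  proof -
    have eq: "U \<inter> K = {x \<in> K. vge 0 (\<phi> x)}"
      using fQ subgroup.subset[OF K(1)] by (auto simp: U_def Zp_iff \<phi>_def)
    show ?thesis
      unfolding lift_def lift_iff_chain[OF TG K phi unb] eq
      by (simp only: not_ex not_all imp_conv_disj de_Morgan_conj not_not disj_assoc)
  qed
  define small where "small K \<longleftrightarrow> subgroup K G \<and> openin T K \<and> finite (rcosets\<^bsub>G\<^esub> K) \<and> card (rcosets\<^bsub>G\<^esub> K) \<le> p ^ k" for K
  define smalln where "smalln K \<longleftrightarrow> K \<lhd> G \<and> openin T K \<and> finite (rcosets\<^bsub>G\<^esub> K) \<and> card (rcosets\<^bsub>G\<^esub> K) dvd p ^ k" for K
  have sub: "small K" if "smalln K" for K
    using that dvd_imp_le[of "card (rcosets\<^bsub>G\<^esub> K)" "p ^ k"]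
    by (auto simp: small_def smalln_def normal_imp_subgroup)
  \<comment> \<open>A lift on any \<open>small\<close> subgroup gives \<open>near\<close>, and
    \<open>near\<close> gives a lift on a \<open>smalln\<close> subgroup, which is also
    \<open>small\<close>. So quantifying over either family yields the same condition.\<close>
  have 1: "\<not> near \<longleftrightarrow> (\<forall>K. small K \<longrightarrow> \<not> lift K)" and 2: "\<not> near \<longleftrightarrow> (\<forall>K. smalln K \<longrightarrow> \<not> lift K)"
    using near_if_lift lift_if_near sub unfolding small_def smalln_def by blast+
  have small: "subgroup K G" "openin T K" "finite (rcosets\<^bsub>G\<^esub> K)" if "small K" for K
    using that by (simp_all add: small_def)
  show ?thesis
    unfolding dist small_def[symmetric] smalln_def[symmetric]
    using 1 2 by (simp add: lift_hom lift_chain small small[OF sub] cong: imp_cong)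
qed

end
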